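(* Let $a\in\mathbb R$, $a\neq0$, and $$W(x)=e^{-x^2}\begin{pmatrix}1+a^2x^4&ax^2\\ ax^2&1\end{pmatrix},\qquad x\in\mathbb R.$$ Consider the operators in $\mathcal D(W)$ $$D_1=\partial^2I+\partial\begin{pmatrix}-2x&4ax\\ 0&-2x\end{pmatrix}+\begin{pmatrix}0&2a\\ 0&4\end{pmatrix},$$ $$\begin{aligned}D_2={}&\partial^4\begin{pmatrix}-ax^2&a^2x^4-1\\ -1&ax^2\end{pmatrix}+\partial^3\begin{pmatrix}-8ax&8a^2x^3+8x\\ 0&0\end{pmatrix}+\partial^2\begin{pmatrix}-12a-\frac8a&12a^2x^2-8x^2+12\\ 0&\frac8a\end{pmatrix}\\ &+\partial\begin{pmatrix}\frac{16x}{a}&-16x\\ 0&-\frac{16x}{a}\end{pmatrix}+\begin{pmatrix}\frac8a&4+\frac{16}{a^2}\\ \frac{16}{a^2}&-\frac8a\end{pmatrix},\end{aligned}$$ $$D_3=\partial^4\begin{pmatrix}1&-ax^2\\ 0&0\end{pmatrix}+\partial^3\begin{pmatrix}-4x&4ax^3\\ 0&0\end{pmatrix}+\partial^2\begin{pmatrix}-10&10ax^2-\frac4a\\ -\frac4a&4x^2\end{pmatrix}+\partial\begin{pmatrix}0&\frac{16x}{a}\\ 0&0\end{pmatrix}+\begin{pmatrix}0&\frac8a\\ 0&\frac{16}{a^2}\end{pmatrix},$$ and define $$Z_1=D_1^3-3D_1^2-\tfrac{4a^2-48}{a^2}D_1-12D_3,\qquad Z_2=D_2^2,$$ $$Z_3=D_1^5-20D_3^2-80D_3D_1-\tfrac{20(a^2-8)}{3a^2}D_1^3-40D_1^2+\tfrac{32(a^4+40a^2+120)}{3a^4}D_1.$$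 Then the center $\mathcal Z(W)$ of $\mathcal D(W)$ is generated by $\{I,Z_1,Z_2,Z_3\}$.
   Context: For a weight matrix $W$ of size $N$ on an interval $(x_0,x_1)$ put $\langle P,Q\rangle_W=\int_{x_0}^{x_1}P(x)W(x)Q(x)^*\,dx$ for $P,Q\in\operatorname{Mat}_N(\mathbb C[x])$. The monic orthogonal polynomials of $W$ are the unique $P_n\in\operatorname{Mat}_N(\mathbb C[x])$, $n\ge0$, of degree $n$ with leading coefficient $I$ and $\langle P_n,P_m\rangle_W=0$ for $n\ne m$. Differential operators $D=\sum_{i=0}^s\partial^iF_i(x)$, $\partial=d/dx$, act on the right on matrix functions: $P\cdot D=\sum_i P^{(i)}F_i$, and products satisfy $P\cdot(D_1D_2)=(P\cdot D_1)\cdot D_2$. $\operatorname{Mat}_N(\Omega[x])$ is the algebra of such operators with coefficients $F_i\in\operatorname{Mat}_N(\mathbb C[x])$. $$\mathcal D(W)=\{D\in\operatorname{Mat}_N(\Omega[x]): P_n\cdot D=\Lambda_n(D)P_n\text{ for some }\Lambda_n(D)\in\operatorname{Mat}_N(\mathbb C),\ \forall n\ge0\}.$$ "Generated" means generated as an algebra over $\mathbb C$. *)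

theory Defs
  imports "HOL-Analysis.Analysis" "HOL-Computational_Algebra.Computational_Algebra"
begin

section \<open>Matrix polynomials\<close>

text \<open>An element of \<open>Mat\<^sub>N(\<complex>[x])\<close> is a matrix of type \<open>complex poly^'n^'n\<close>, with \<open>'n\<close> a type of
  \<open>N\<close> elements. Matrix products are always \<open>**\<close>; the operation \<open>*\<close> on these types is entrywise
  and is not used.\<close>

abbreviation mat2 :: "'a::zero \<Rightarrow> 'a \<Rightarrow> 'a \<Rightarrow> 'a \<Rightarrow> 'a^2^2" where
  "mat2 p q r s \<equiv> vector [vector [p, q], vector [r, s]]"

definition mat_const :: "complex^'n^'n \<Rightarrow> complex poly^'n^'n" where
  "mat_const A = (\<chi> i j. [:A$i$j:])"

definition mat_eval :: "complex poly^'n^'n \<Rightarrow> real \<Rightarrow> complex^'n^'n" where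
  "mat_eval P x = (\<chi> i j. poly (P$i$j) (of_real x))"

definition mat_deriv :: "complex poly^'n^'n \<Rightarrow> complex poly^'n^'n" where
  "mat_deriv P = (\<chi> i j. pderiv (P$i$j))"

definition mat_smult :: "complex \<Rightarrow> complex poly^'n^'n \<Rightarrow> complex poly^'n^'n" where
  "mat_smult c P = (\<chi> i j. smult c (P$i$j))"

definition conj_transpose :: "complex^'n^'m \<Rightarrow> complex^'m^'n" where
  "conj_transpose A = (\<chi> i j. cnj (A$j$i))"

definition monic_of_degree :: "nat \<Rightarrow> complex poly^'n^'n \<Rightarrow> bool" where
  "monic_of_degree n P \<longleftrightarrow>
     (\<forall>i j. degree (P$i$j) \<le> n) \<and> (\<chi> i j. coeff (P$i$j) n) = (mat 1 :: complex^'n^'n)"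

section \<open>Orthogonal polynomials of a weight matrix\<close>

text \<open>The endpoints of the interval are extended reals. The integral is a Bochner integral of a
  matrix-valued function.\<close>

definition weight_inner ::
    "ereal \<Rightarrow> ereal \<Rightarrow> (real \<Rightarrow> complex^'n^'n) \<Rightarrow> complex poly^'n^'n \<Rightarrow> complex poly^'n^'n \<Rightarrow> complex^'n^'n"
  where "weight_inner x0 x1 W P Q =
    (LBINT x=x0..x1. mat_eval P x ** W x ** conj_transpose (mat_eval Q x))"

definition is_monic_orthogonal ::
    "ereal \<Rightarrow> ereal \<Rightarrow> (real \<Rightarrow> complex^'n^'n) \<Rightarrow> (nat \<Rightarrow> complex poly^'n^'n) \<Rightarrow> bool" where
  "is_monic_orthogonal x0 x1 W P \<longleftrightarrow>
     (\<forall>n. monic_of_degree n (P n)) \<and> (\<forall>n m. n \<noteq> m \<longrightarrow> weight_inner x0 x1 W (P n) (P m) = 0)"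

text \<open>For a weight matrix (positive definite almost everywhere, finite moments) this sequence exists
  and is unique.\<close>

definition monic_orthogonal ::
    "ereal \<Rightarrow> ereal \<Rightarrow> (real \<Rightarrow> complex^'n^'n) \<Rightarrow> nat \<Rightarrow> complex poly^'n^'n" where
  "monic_orthogonal x0 x1 W = (THE P. is_monic_orthogonal x0 x1 W P)"

section \<open>Differential operators acting on the right\<close>

text \<open>\<open>Mat\<^sub>N(\<Omega>[x])\<close>: the operator \<open>\<Sum>\<^sub>i \<partial>\<^sup>i F\<^sub>i(x)\<close> is stored as the polynomial in the formal symbol
  \<open>\<partial>\<close> with matrix coefficients \<open>F\<^sub>i\<close>. The type is a separate one because its product is not the
  product of type \<open>poly\<close>.\<close>

typedef (overloaded) ('n::finite) diffop = "UNIV :: (complex poly^'n^'n) poly set"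
  morphisms symbol Diffop ..

lemmas diffop_symbol [simp] = symbol_inverse Diffop_inverse [OF UNIV_I]

abbreviation dcoeff :: "'n::finite diffop \<Rightarrow> nat \<Rightarrow> complex poly^'n^'n" where
  "dcoeff D i \<equiv> coeff (symbol D) i"

definition dterm :: "nat \<Rightarrow> complex poly^'n^'n \<Rightarrow> 'n::finite diffop" where
  "dterm i F = Diffop (monom F i)"

definition dact :: "complex poly^'n^'n \<Rightarrow> 'n::finite diffop \<Rightarrow> complex poly^'n^'n" (infixl "\<bullet>\<^sub>D" 70) where
  "P \<bullet>\<^sub>D D = (\<Sum>i\<le>degree (symbol D). (mat_deriv ^^ i) P ** dcoeff D i)"

definition dscale :: "complex \<Rightarrow> 'n::finite diffop \<Rightarrow> 'n diffop" (infixr "*\<^sub>D" 75) where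
  "c *\<^sub>D D = Diffop (map_poly (mat_smult c) (symbol D))"

instantiation diffop :: (finite) ab_group_add
begin
definition "0 = Diffop 0"
definition "D + E = Diffop (symbol D + symbol E)"
definition "D - E = Diffop (symbol D - symbol E)"
definition "- D = Diffop (- symbol D)"
instance
  by standard (simp_all add: zero_diffop_def plus_diffop_def minus_diffop_def uminus_diffop_def
      algebra_simps)
end

text \<open>The product is determined by \<open>P \<bullet>\<^sub>D (D * E) = (P \<bullet>\<^sub>D D) \<bullet>\<^sub>D E\<close> (lemmas \<open>dact_times\<close> and
  \<open>dact_inject\<close> below). The formula is Leibniz' rule
  \<open>\<partial>\<^sup>i F \<cdot> \<partial>\<^sup>j G = \<Sum>\<^sub>k (j choose k) \<partial>\<^sup>i\<^sup>+\<^sup>j\<^sup>-\<^sup>k F\<^sup>(\<^sup>k\<^sup>) G\<close>.\<close>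

definition dtimes :: "'n::finite diffop \<Rightarrow> 'n diffop \<Rightarrow> 'n diffop" where
  "dtimes D E = (\<Sum>i\<le>degree (symbol D). \<Sum>j\<le>degree (symbol E). \<Sum>k\<le>j.
     dterm (i + j - k)
       (mat_smult (of_nat (j choose k)) ((mat_deriv ^^ k) (dcoeff D i) ** dcoeff E j)))"

lemma mat_deriv_add: "mat_deriv (P + Q) = mat_deriv P + mat_deriv Q"
  by (simp add: mat_deriv_def vec_eq_iff pderiv_add)

lemma mat_deriv_0 [simp]: "mat_deriv 0 = 0"
  by (simp add: mat_deriv_def vec_eq_iff)

lemma mat_deriv_sum: "mat_deriv (sum f A) = (\<Sum>i\<in>A. mat_deriv (f i))"
  by (induction A rule: infinite_finite_induct) (auto simp: mat_deriv_add)

lemma mat_deriv_smult: "mat_deriv (mat_smult c P) = mat_smult c (mat_deriv P)"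
  by (simp add: mat_deriv_def mat_smult_def vec_eq_iff pderiv_smult)

lemma mat_deriv_mult: "mat_deriv (P ** Q) = mat_deriv P ** Q + P ** mat_deriv Q"
  by (simp add: mat_deriv_def vec_eq_iff matrix_matrix_mult_def higher_pderiv_sum [of 1, simplified] pderiv_mult
      sum.distrib [symmetric] algebra_simps)

lemma funpow_mat_deriv_add: "(mat_deriv ^^ k) (P + Q) = (mat_deriv ^^ k) P + (mat_deriv ^^ k) Q"
  by (induction k) (auto simp: mat_deriv_add)

lemma funpow_mat_deriv_0 [simp]: "(mat_deriv ^^ k) 0 = 0"
  by (induction k) auto

lemma funpow_mat_deriv_sum: "(mat_deriv ^^ k) (sum f A) = (\<Sum>i\<in>A. (mat_deriv ^^ k) (f i))"
  by (induction A rule: infinite_finite_induct) (auto simp: funpow_mat_deriv_add)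

lemma mat_smult_add_right: "mat_smult c (P + Q) = mat_smult c P + mat_smult c Q"
  by (simp add: mat_smult_def vec_eq_iff smult_add_right)

lemma mat_smult_add_left: "mat_smult (c + d) P = mat_smult c P + mat_smult d P"
  by (simp add: mat_smult_def vec_eq_iff smult_add_left)

lemma mat_smult_0 [simp]: "mat_smult c 0 = 0" "mat_smult 0 P = 0"
  and mat_smult_1 [simp]: "mat_smult 1 P = P"
  by (simp_all add: mat_smult_def vec_eq_iff)

lemma sum_smult: "smult (c :: complex) (sum f A) = (\<Sum>i\<in>A. smult c (f i))"
  by (induction A rule: infinite_finite_induct) (auto simp: smult_add_right)

lemma mat_smult_mult_left: "mat_smult c P ** Q = mat_smult c (P ** Q)"
  and mat_smult_mult_right: "P ** mat_smult c Q = mat_smult c (P ** Q)"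
  by (simp_all add: mat_smult_def vec_eq_iff matrix_matrix_mult_def sum_smult)

lemma mat_mult_add_left: "((P :: complex poly^'n^'n) + R) ** Q = P ** Q + R ** Q"
  by (simp add: vec_eq_iff matrix_matrix_mult_def sum.distrib algebra_simps)

lemma mat_mult_0 [simp]: "(0 :: complex poly^'n^'n) ** Q = 0" "Q ** (0 :: complex poly^'n^'n) = 0"
  by (simp_all add: vec_eq_iff matrix_matrix_mult_def)

lemma mat_mult_sum_left: "sum (f :: _ \<Rightarrow> complex poly^'n^'n) A ** Q = (\<Sum>i\<in>A. f i ** Q)"
  by (induction A rule: infinite_finite_induct) (auto simp: mat_mult_add_left)

lemma mat_deriv_leibniz:
  "(mat_deriv ^^ j) (P ** Q) =
     (\<Sum>k\<le>j. mat_smult (of_nat (j choose k)) ((mat_deriv ^^ (j - k)) P ** (mat_deriv ^^ k) Q))"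
proof (induction j)
  case 0
  show ?case by simp
next
  case (Suc j)
  define t where "t = (\<lambda>r s. (mat_deriv ^^ r) P ** (mat_deriv ^^ s) Q)"
  define c where "c = (\<lambda>n k. complex_of_nat (n choose k))"
  have d: "mat_deriv (t r s) = t (Suc r) s + t r (Suc s)" for r s
    by (simp add: t_def mat_deriv_mult)
  have "(mat_deriv ^^ Suc j) (P ** Q) =
      (\<Sum>k\<le>j. mat_smult (c j k) (t (Suc j - k) k)) + (\<Sum>k\<le>j. mat_smult (c j k) (t (j - k) (Suc k)))"
    by (simp add: Suc.IH mat_deriv_sum mat_deriv_smult mat_deriv_mult mat_smult_add_right
        sum.distrib t_def c_def Suc_diff_le)
  also have "(\<Sum>k\<le>j. mat_smult (c j k) (t (Suc j - k) k)) =
      (\<Sum>k\<le>Suc j. mat_smult (c j k) (t (Suc j - k) k))"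
    by (simp add: c_def binomial_eq_0)
  also have "\<dots> = t (Suc j) 0 + (\<Sum>k\<le>j. mat_smult (c j (Suc k)) (t (j - k) (Suc k)))"
    by (subst sum.atMost_Suc_shift) (simp add: c_def)
  also have "\<dots> + (\<Sum>k\<le>j. mat_smult (c j k) (t (j - k) (Suc k))) =
      t (Suc j) 0 + (\<Sum>k\<le>j. mat_smult (c (Suc j) (Suc k)) (t (j - k) (Suc k)))"
    by (simp add: c_def mat_smult_add_left sum.distrib add_ac)
  also have "\<dots> = (\<Sum>k\<le>Suc j. mat_smult (c (Suc j) k) (t (Suc j - k) k))"
    by (simp only: sum.atMost_Suc_shift) (simp add: c_def)
  finally show ?case by (simp only: t_def c_def)
qed

lemma dact_bound:
  assumes "degree (symbol D) \<le> n"
  shows "P \<bullet>\<^sub>D D = (\<Sum>i\<le>n. (mat_deriv ^^ i) P ** dcoeff D i)"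
  unfolding dact_def
  by (rule sum.mono_neutral_left) (use assms in \<open>auto simp: coeff_eq_0\<close>)

lemma dact_add_right: "P \<bullet>\<^sub>D (D + E) = P \<bullet>\<^sub>D D + P \<bullet>\<^sub>D E"
proof -
  define n where "n = max (degree (symbol D)) (degree (symbol E))"
  have "degree (symbol (D + E)) \<le> n"
    by (simp add: plus_diffop_def n_def degree_add_le_max)
  then show ?thesis
    by (simp add: dact_bound [of _ n] n_def plus_diffop_def matrix_add_ldistrib sum.distrib)
qed

lemma dact_0_right [simp]: "P \<bullet>\<^sub>D 0 = 0"
  by (simp add: dact_def zero_diffop_def)

lemma dact_sum_right: "P \<bullet>\<^sub>D (sum f A) = (\<Sum>i\<in>A. P \<bullet>\<^sub>D f i)"
  by (induction A rule: infinite_finite_induct) (auto simp: dact_add_right)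

lemma dact_add_left: "(P + Q) \<bullet>\<^sub>D D = P \<bullet>\<^sub>D D + Q \<bullet>\<^sub>D D"
  by (simp add: dact_def funpow_mat_deriv_add mat_mult_add_left sum.distrib)

lemma dact_dterm: "P \<bullet>\<^sub>D dterm i F = (mat_deriv ^^ i) P ** F"
proof -
  have "P \<bullet>\<^sub>D dterm i F = (\<Sum>j\<le>i. (mat_deriv ^^ j) P ** (if i = j then F else 0))"
    by (simp add: dact_bound [of _ i] dterm_def degree_monom_le)
  also have "\<dots> = (\<Sum>j\<le>i. if i = j then (mat_deriv ^^ j) P ** F else 0)"
    by (intro sum.cong) auto
  finally show ?thesis by simp
qed

lemma dact_times: "P \<bullet>\<^sub>D (dtimes D E) = (P \<bullet>\<^sub>D D) \<bullet>\<^sub>D E"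
proof -
  have "(\<Sum>k\<le>j. P \<bullet>\<^sub>D dterm (i + j - k)
       (mat_smult (of_nat (j choose k)) ((mat_deriv ^^ k) F ** G))) =
     (mat_deriv ^^ j) ((mat_deriv ^^ i) P ** F) ** G" for i j F G
    unfolding mat_deriv_leibniz mat_mult_sum_left
  proof (rule sum.cong)
    fix k assume "k \<in> {..j}"
    then have "i + j - k = (j - k) + i" by simp
    then have "(mat_deriv ^^ (i + j - k)) P = (mat_deriv ^^ (j - k)) ((mat_deriv ^^ i) P)"
      by (simp only: funpow_add comp_def)
    then show "P \<bullet>\<^sub>D dterm (i + j - k)
         (mat_smult (of_nat (j choose k)) ((mat_deriv ^^ k) F ** G)) =
       mat_smult (of_nat (j choose k))
         ((mat_deriv ^^ (j - k)) ((mat_deriv ^^ i) P) ** (mat_deriv ^^ k) F) ** G"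
      by (simp add: dact_dterm mat_smult_mult_left mat_smult_mult_right matrix_mul_assoc)
  qed simp
  then show ?thesis
    unfolding dtimes_def dact_sum_right
    by (subst sum.swap)
      (simp add: dact_def funpow_mat_deriv_sum mat_mult_sum_left)
qed

lemma mat_mult_component: "(mat p ** F) $ i $ j = p * (F :: complex poly^'n^'n) $ i $ j"
  by (simp add: matrix_matrix_mult_def mat_def if_distrib [of "\<lambda>x. x * _"] cong: if_cong)

lemma funpow_mat_deriv_mat: "(mat_deriv ^^ k) (mat p) = mat ((pderiv ^^ k) p)"
  by (induction k) (auto simp: mat_deriv_def mat_def vec_eq_iff)

lemma dact_eq_0:
  assumes "\<And>P. P \<bullet>\<^sub>D D = 0"
  shows "D = 0"
proof -
  have "dcoeff D n = 0" for n
  proof (induction n rule: less_induct)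
    case (less n)
    define N where "N = max n (degree (symbol D))"
    have "(pderiv ^^ n) (monom c n) = ([:c * fact n:] :: complex poly)" for c
      by (induction n arbitrary: c)
        (auto simp: monom_0 pderiv_monom funpow_Suc_right simp del: funpow.simps(2))
    then have nth: "(pderiv ^^ n) (monom 1 n) = ([:fact n:] :: complex poly)" by simp
    have hi: "(pderiv ^^ i) (monom 1 n) = (0 :: complex poly)" if "n < i" for i
    proof -
      obtain l where "i = l + Suc n"
        using \<open>n < i\<close> by (metis less_iff_Suc_add add.commute add_Suc_right)
      then show ?thesis
        by (simp only: funpow_add comp_def funpow.simps(2) nth) (simp add: pderiv_pCons)
    qed
    have "0 = (\<Sum>i\<le>N. mat ((pderiv ^^ i) (monom 1 n)) ** dcoeff D i)"
      using assms [of "mat (monom 1 n)"]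
      by (simp add: dact_bound [of _ N] N_def funpow_mat_deriv_mat)
    also have "\<dots> = (\<Sum>i\<le>N. if i = n then mat [:fact n:] ** dcoeff D n else 0)"
    proof (rule sum.cong)
      fix i
      consider "i < n" | "i = n" | "n < i" by linarith
      then show "mat ((pderiv ^^ i) (monom 1 n)) ** dcoeff D i =
          (if i = n then mat [:fact n:] ** dcoeff D n else 0)"
        by cases (auto simp: less.IH nth hi mat_0)
    qed simp
    also have "\<dots> = mat [:fact n:] ** dcoeff D n"
      by (simp add: N_def)
    finally have "mat [:fact n:] ** dcoeff D n = 0" ..
    then have "[:fact n:] * dcoeff D n $ i $ j = 0" for i j
      using mat_mult_component [of "[:fact n:]" "dcoeff D n" i j] by simp
    then show "dcoeff D n = 0"
      by (simp add: vec_eq_iff)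
  qed
  then have "symbol D = 0" by (simp add: poly_eq_iff)
  then show ?thesis by (metis symbol_inverse zero_diffop_def)
qed

lemma dact_diff_right: "P \<bullet>\<^sub>D (D - E) = P \<bullet>\<^sub>D D - P \<bullet>\<^sub>D E"
  using dact_add_right [of P "D - E" E] by simp

lemma dact_inject: "(\<forall>P. P \<bullet>\<^sub>D D = P \<bullet>\<^sub>D E) \<longleftrightarrow> D = E"
  using dact_eq_0 [of "D - E"] by (auto simp: dact_diff_right)

instantiation diffop :: (finite) ring_1
begin
definition one_diffop :: "'a diffop" where "1 = dterm 0 (mat 1)"
definition times_diffop :: "'a diffop \<Rightarrow> 'a diffop \<Rightarrow> 'a diffop" where "times_diffop = dtimes"
instance
proof
  have one: "P \<bullet>\<^sub>D 1 = P" for P :: "complex poly^'a^'a"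
    by (simp add: one_diffop_def dact_dterm)
  have times: "P \<bullet>\<^sub>D (D * E) = (P \<bullet>\<^sub>D D) \<bullet>\<^sub>D E" for P and D E :: "'a diffop"
    by (simp add: times_diffop_def dact_times)
  fix A B C :: "'a diffop"
  show "A * B * C = A * (B * C)" "1 * A = A" "A * 1 = A"
    "(A + B) * C = A * C + B * C" "A * (B + C) = A * B + A * C"
    by (simp_all add: one times dact_add_left dact_add_right flip: dact_inject)
  show "(0 :: 'a diffop) \<noteq> 1"
  proof
    assume "(0 :: 'a diffop) = 1"
    then have "(mat 1 :: complex poly^'a^'a) = 0"
      by (metis one dact_0_right)
    then have "(mat 1 :: complex poly^'a^'a) $ i $ i = 0" for i by simp
    then show False by (simp add: mat_def)
  qed
qed
end

section \<open>The algebra of a weight, centers and generated algebras\<close>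

definition weight_algebra :: "ereal \<Rightarrow> ereal \<Rightarrow> (real \<Rightarrow> complex^'n^'n) \<Rightarrow> 'n::finite diffop set" where
  "weight_algebra x0 x1 W =
     {D. \<forall>n. \<exists>\<Lambda>. monic_orthogonal x0 x1 W n \<bullet>\<^sub>D D = mat_const \<Lambda> ** monic_orthogonal x0 x1 W n}"

definition center :: "'a::times set \<Rightarrow> 'a set" where
  "center A = {z \<in> A. \<forall>d\<in>A. z * d = d * z}"

definition is_subalgebra :: "'n::finite diffop set \<Rightarrow> bool" where
  "is_subalgebra A \<longleftrightarrow>
     1 \<in> A \<and> (\<forall>D\<in>A. \<forall>E\<in>A. D + E \<in> A \<and> D * E \<in> A) \<and> (\<forall>c. \<forall>D\<in>A. c *\<^sub>D D \<in> A)"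

abbreviation generated_algebra :: "'n::finite diffop set \<Rightarrow> 'n diffop set" where
  "generated_algebra S \<equiv> is_subalgebra hull S"

section \<open>The example\<close>

definition W :: "real \<Rightarrow> real \<Rightarrow> complex^2^2" where
  "W a x = (let e = \<lambda>t. complex_of_real (exp (- (x^2)) * t) in
     mat2 (e (1 + a^2 * x^4)) (e (a * x^2))
          (e (a * x^2))       (e 1))"

text \<open>In the operators below the parameter is complex; it is instantiated with a real number.
  Entries are polynomials in \<open>x\<close> with the constant coefficient first.\<close>

definition D1 :: "complex \<Rightarrow> 2 diffop" where
  "D1 a =
     dterm 2 (mat2 1 0
                   0 1)
   + dterm 1 (mat2 [:0, -2:] [:0, 4 * a:]
                   0         [:0, -2:])
   + dterm 0 (mat2 0 [:2 * a:]
                   0 [:4:])"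

definition D2 :: "complex \<Rightarrow> 2 diffop" where
  "D2 a =
     dterm 4 (mat2 [:0, 0, - a:] [:-1, 0, 0, 0, a^2:]
                   [:-1:]        [:0, 0, a:])
   + dterm 3 (mat2 [:0, - 8 * a:] [:0, 8, 0, 8 * a^2:]
                   0              0)
   + dterm 2 (mat2 [:- 12 * a - 8 / a:] [:12, 0, 12 * a^2 - 8:]
                   0                    [:8 / a:])
   + dterm 1 (mat2 [:0, 16 / a:] [:0, -16:]
                   0             [:0, - (16 / a):])
   + dterm 0 (mat2 [:8 / a:]    [:4 + 16 / a^2:]
                   [:16 / a^2:] [:- (8 / a):])"

definition D3 :: "complex \<Rightarrow> 2 diffop" where
  "D3 a =
     dterm 4 (mat2 1 [:0, 0, - a:]
                   0 0)
   + dterm 3 (mat2 [:0, -4:] [:0, 0, 0, 4 * a:]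
                   0         0)
   + dterm 2 (mat2 [:-10:]       [:- (4 / a), 0, 10 * a:]
                   [:- (4 / a):] [:0, 0, 4:])
   + dterm 1 (mat2 0 [:0, 16 / a:]
                   0 0)
   + dterm 0 (mat2 0 [:8 / a:]
                   0 [:16 / a^2:])"

definition Z1 :: "complex \<Rightarrow> 2 diffop" where
  "Z1 a = D1 a ^ 3 - 3 *\<^sub>D D1 a ^ 2 - ((4 * a^2 - 48) / a^2) *\<^sub>D D1 a - 12 *\<^sub>D D3 a"

definition Z2 :: "complex \<Rightarrow> 2 diffop" where
  "Z2 a = D2 a ^ 2"

definition Z3 :: "complex \<Rightarrow> 2 diffop" where
  "Z3 a = D1 a ^ 5 - 20 *\<^sub>D D3 a ^ 2 - 80 *\<^sub>D (D3 a * D1 a)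
     - (20 * (a^2 - 8) / (3 * a^2)) *\<^sub>D D1 a ^ 3 - 40 *\<^sub>D D1 a ^ 2
     + (32 * (a^4 + 40 * a^2 + 120) / (3 * a^4)) *\<^sub>D D1 a"

end

theory Submission
  imports Defs "HOL-Probability.Distributions"
begin

text \<open>The weight factors as \<open>W = exp (-x\<^sup>2) T T\<^sup>*\<close> with \<open>T\<close> unipotent, so the rows of the orthogonal polynomials
  times \<open>T\<close> are built from monic Hermite polynomials \<open>h\<^sub>n\<close>: up to a constant left factor they are
  \<open>v\<^sub>n = (h\<^sub>n, a h\<^sub>n\<^sub>+\<^sub>2)\<close> and \<open>u\<^sub>n = (a/4 h\<^sub>n'', -h\<^sub>n)\<close>. On these rows \<open>D\<^sub>1\<close> acts diagonally with distinct
  eigenvalues and \<open>D\<^sub>2\<close> interchanges the two lines, so a central operator acts on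
  \<open>span (v\<^sub>n, u\<^sub>n)\<close> as a scalar \<open>z n\<close>. Comparing leading coefficients shows that \<open>z\<close> is a polynomial in \<open>n\<close>.
  Since \<open>(h\<^sub>n, 0)\<close> is a combination of \<open>v\<^sub>n\<close> and \<open>u\<^sub>n\<^sub>+\<^sub>2\<close>, the same comparison for this row shows that
  \<open>4 + a\<^sup>2 (n + 1) (n + 2)\<close> divides \<open>z (n + 2) - z n\<close>. Hence \<open>z\<close> is constant or has degree at least \<open>3\<close>, and
  \<open>Z\<^sub>1, Z\<^sub>2, Z\<^sub>3\<close> have eigenvalues of degrees \<open>3, 4, 5\<close>, which generate all degrees \<open>\<ge> 3\<close>.\<close>

no_notation fps_nth (infixl "$" 75)

subsection \<open>Hermite polynomials\<close>

text \<open>The raising operator p -> x p - p'/2 is half the adjoint of d/dx for exp(-x^2) dx.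
  Iterating it on 1 gives 2^(-n) times the physicists' Hermite polynomials and makes orthogonality a
  matter of integration by parts.\<close>

fun hermite :: "nat \<Rightarrow> complex poly" where
  "hermite 0 = 1"
| "hermite (Suc n) = [:0, 1:] * hermite n - smult (1/2) (pderiv (hermite n))"

text \<open>The Hermite equation and the lowering relation are proved together: lowering for h_(n+1)
  and the recursion give the equation for h_(n+1), which in turn gives lowering for h_(n+2).\<close>

lemma hermite_ode_and_pderiv:
  "pderiv (pderiv (hermite n)) = [:0, 2:] * pderiv (hermite n) - smult (2 * of_nat n) (hermite n) \<and>
   pderiv (hermite (Suc n)) = smult (of_nat (Suc n)) (hermite n)"
proof (induction n)
  case 0
  show ?case by (simp add: pderiv_pCons)
next
  case (Suc n)
  let ?h = "hermite n" and ?k = "hermite (Suc n)"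
  have k': "pderiv ?k = smult (of_nat (Suc n)) ?h" using Suc by blast
  have "pderiv (pderiv ?k) = smult (of_nat (Suc n)) (pderiv ?h)"
    by (simp only: k' pderiv_smult)
  also have "\<dots> = [:0, 2:] * pderiv ?k - smult (2 * of_nat (Suc n)) ?k"
    unfolding k' unfolding hermite.simps
    by (rule iffD1[OF poly_eq_poly_eq_iff], rule ext) (simp add: algebra_simps)
  finally have ode: "pderiv (pderiv ?k) = [:0, 2:] * pderiv ?k - smult (2 * of_nat (Suc n)) ?k" .
  have "pderiv (hermite (Suc (Suc n))) = ?k + [:0,1:] * pderiv ?k - smult (1/2) (pderiv (pderiv ?k))"
    by (simp only: hermite.simps(2)[of "Suc n"] pderiv_diff pderiv_smult pderiv_mult)
       (simp add: pderiv_pCons)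
  also have "\<dots> = smult (of_nat (Suc (Suc n))) ?k"
    unfolding ode
    by (rule iffD1[OF poly_eq_poly_eq_iff], rule ext) (simp add: algebra_simps)
  finally show ?case using ode by blast
qed

lemmas hermite_ode = hermite_ode_and_pderiv[THEN conjunct1]
  and pderiv_hermite_Suc = hermite_ode_and_pderiv[THEN conjunct2]

text \<open>The rows are \<open>v\<^sub>n T\<^sup>-\<^sup>1\<close> and \<open>u\<^sub>n T\<^sup>-\<^sup>1\<close>. The second derivative stands for \<open>n (n - 1) h\<^sub>n\<^sub>-\<^sub>2\<close>, which avoids
  the negative indices for \<open>n < 2\<close>.\<close>

definition hermite_rows :: "complex \<Rightarrow> nat \<Rightarrow> complex poly^2^2" where
  "hermite_rows a n = (let h = hermite n; w = smult (a / 4) (pderiv (pderiv h)) in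
     mat2 h (smult a (hermite (Suc (Suc n)) - [:0, 0, 1:] * h))
          w (- h - [:0, 0, a:] * w))"

text \<open>The two leading degrees of h_(n+2) - x^2 h_n cancel, and the remainder is expressed
  through h_n and x h_n'.\<close>

lemma hermite_plus2: "hermite (Suc (Suc n)) - [:0, 0, 1:] * hermite n =
   - smult (1/2) ([:0, 1:] * pderiv (hermite n)) - smult ((of_nat n + 1)/2) (hermite n)"
proof -
  have "hermite (Suc (Suc n)) = [:0,1:] * hermite (Suc n) - smult ((of_nat n + 1)/2) (hermite n)"
    by (subst hermite.simps(2)) (simp add: pderiv_hermite_Suc add.commute del: hermite.simps)
  then show ?thesis
    unfolding hermite.simps(2)[of n]
    by (simp only:) (rule iffD1[OF poly_eq_poly_eq_iff], rule ext, simp add: algebra_simps)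
qed

lemma coeff_hermite: "n \<le> k \<Longrightarrow> coeff (hermite n) k = (if k = n then 1 else 0)"
proof (induction n arbitrary: k)
  case 0
  then show ?case by (simp add: coeff_pCons split: nat.split)
next
  case (Suc n)
  then show ?case by (cases k) (auto simp: coeff_pderiv)
qed

lemma degree_hermite_le: "degree (hermite n) \<le> n"
  by (rule degree_le) (simp add: coeff_hermite)

lemma coeff_X_pderiv: "coeff ([:0, 1:] * pderiv p) k = of_nat k * coeff p k"
  by (cases k) (simp_all add: coeff_pderiv)

lemma coeff_X2_pderiv2:
  "coeff ([:0, 0, 1:] * pderiv (pderiv p)) k = of_nat k * (of_nat k - 1) * coeff (p :: complex poly) k"
  by (cases k; cases "k - 1") (auto simp: coeff_pderiv coeff_pCons)

lemma mat2_nth [simp]: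
  "(mat2 p q r s :: 'a::zero^2^2) $ 1 $ 1 = p" "(mat2 p q r s :: 'a::zero^2^2) $ 1 $ 2 = q"
  "(mat2 p q r s :: 'a::zero^2^2) $ 2 $ 1 = r" "(mat2 p q r s :: 'a::zero^2^2) $ 2 $ 2 = s"
  by simp_all

lemma mat2_eqI:
  fixes A B :: "'a^2^2"
  assumes "A $ 1 $ 1 = B $ 1 $ 1" "A $ 1 $ 2 = B $ 1 $ 2" "A $ 2 $ 1 = B $ 2 $ 1" "A $ 2 $ 2 = B $ 2 $ 2"
  shows "A = B"
  using assms by (simp add: vec_eq_iff forall_2)

lemma mat_deriv_nth [simp]: "mat_deriv P $ i $ j = pderiv (P $ i $ j)"
  by (simp add: mat_deriv_def)

lemma funpow_mat_deriv_nth: "(mat_deriv ^^ k) P $ i $ j = (pderiv ^^ k) (P $ i $ j)"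
  by (induction k) auto

lemma mult2_nth: "((A :: 'a::semiring_1^2^2) ** B) $ i $ j = A $ i $ 1 * B $ 1 $ j + A $ i $ 2 * B $ 2 $ j"
  by (simp add: matrix_matrix_mult_def sum_2)

lemma mat_const_nth [simp]: "mat_const A $ i $ j = [:A $ i $ j:]"
  by (simp add: mat_const_def)

text \<open>Only h_n and its derivatives occur here, the latter mostly through x d/dx and x^2
  d^2/dx^2. These scale each monomial, so degrees and leading coefficients can be read off.\<close>

lemma hermite_rows_alt:
  "hermite_rows a n = (let h = hermite n in
     mat2 h (- smult (a/2) ([:0, 1:] * pderiv h) - smult (a * (of_nat n + 1)/2) h)
          (smult (a/4) (pderiv (pderiv h))) (- h - smult (a^2/4) ([:0,0,1:] * pderiv (pderiv h))))"
  unfolding hermite_rows_def Let_def hermite_plus2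
  by (rule mat2_eqI) (simp_all add: smult_diff_right algebra_simps power2_eq_square)

section \<open>Action of D_1, D_2, D_3 on the Hermite rows\<close>

context
  fixes a :: complex and n :: nat and H :: "nat \<Rightarrow> complex poly"
  assumes a0: "a \<noteq> 0"
  defines "H \<equiv> \<lambda>k. (pderiv ^^ k) (hermite n)"
begin

lemma pderiv_H: "pderiv (H k) = H (Suc k)" by (simp add: H_def)

text \<open>This is the Hermite equation differentiated k times. It reduces all derivatives to
  \<open>H 0\<close> and \<open>H 1\<close>, so the operator identities below become polynomial
  identities in t and the values of these two.\<close>

lemma H_rec: "H (Suc (Suc k)) = [:0, 2:] * H (Suc k) - smult (2 * (of_nat n - of_nat k)) (H k)"
proof (induction k)
  case 0
  show ?case using hermite_ode[of n] by (simp add: H_def)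
next
  case (Suc k)
  have "H (Suc (Suc (Suc k))) = pderiv (H (Suc (Suc k)))" by (simp add: pderiv_H)
  also have "\<dots> = [:2:] * H (Suc k) + [:0,2:] * H (Suc (Suc k)) - smult (2 * (of_nat n - of_nat k)) (H (Suc k))"
    unfolding Suc.IH pderiv_diff pderiv_mult pderiv_smult pderiv_H by (simp add: pderiv_pCons)
  also have "\<dots> = [:0, 2:] * H (Suc (Suc k)) - smult (2 * (of_nat n - of_nat (Suc k))) (H (Suc k))"
    by (rule iffD1[OF poly_eq_poly_eq_iff], rule ext) (simp add: algebra_simps)
  finally show ?case .
qed

lemma hermite_rows_H: "hermite_rows a n = mat2 (H 0) (- smult (a/2) ([:0, 1:] * H 1) - smult (a * (of_nat n + 1)/2) (H 0))
          (smult (a/4) (H 2)) (- H 0 - smult (a^2/4) ([:0,0,1:] * H 2))"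
  by (simp add: hermite_rows_alt Let_def H_def numeral_2_eq_2)

lemma poly_H: "poly (H (Suc (Suc k))) t = 2 * t * poly (H (Suc k)) t - 2 * (of_nat n - of_nat k) * poly (H k) t"
  by (simp add: H_rec)

lemmas row_simps = mult2_nth funpow_mat_deriv_nth numeral_eq_Suc pderiv_mult pderiv_add pderiv_diff
  pderiv_minus pderiv_smult pderiv_pCons pderiv_H poly_H

text \<open>Conjugated by T, D_1 is diag(d, d + 4) with d the Hermite operator p -> p'' - 2 x p'.
  The summand 4 offsets the index difference 2 between the two entries of v_n and of u_n.\<close>

lemma hermite_rows_D1: "hermite_rows a n \<bullet>\<^sub>D D1 a = mat_const (mat2 (- 2 * of_nat n) 0 0 (4 - 2 * of_nat n)) ** hermite_rows a n"
  unfolding hermite_rows_H D1_def dact_add_right dact_dterm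
  by (rule mat2_eqI; rule iffD1[OF poly_eq_poly_eq_iff]; rule ext;
    simp add: row_simps;
    simp add: field_simps a0)

text \<open>The two entries are -16/a^2 times 1 + a^2 (n+1)(n+2)/4 and 1 + a^2 n(n-1)/4. The latter
  is, up to sign, the determinant of the leading coefficient of \<open>hermite_rows a n\<close>, and
  the former is the same quantity at n + 2.\<close>

lemma hermite_rows_D2: "hermite_rows a n \<bullet>\<^sub>D D2 a =
  mat_const (mat2 0 (- 16 / a^2 - 4 * (of_nat n + 1) * (of_nat n + 2))
                  (- 16 / a^2 - 4 * of_nat n * (of_nat n - 1)) 0) ** hermite_rows a n"
  unfolding hermite_rows_H D2_def dact_add_right dact_dterm
  by (rule mat2_eqI; rule iffD1[OF poly_eq_poly_eq_iff]; rule ext;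
    simp add: row_simps;
    simp add: field_simps a0)

text \<open>D_3 kills the row of v_n. It can therefore correct the eigenvalue on u_n alone, which is
  its purpose in Z_1 and Z_3.\<close>

lemma hermite_rows_D3: "hermite_rows a n \<bullet>\<^sub>D D3 a = mat_const (mat2 0 0 0 (16 / a^2 + 4 * of_nat n * (of_nat n - 1))) ** hermite_rows a n"
  unfolding hermite_rows_H D3_def dact_add_right dact_dterm
  by (rule mat2_eqI; rule iffD1[OF poly_eq_poly_eq_iff]; rule ext;
    simp add: row_simps;
    simp add: field_simps a0)

end

subsection \<open>Gaussian moments\<close>

definition gauss_moment :: "nat \<Rightarrow> real" where
  "gauss_moment k = (if even k then sqrt pi * (fact k / (2 ^ k * fact (k div 2))) else 0)"

lemma has_bochner_integral_gauss_moment: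
  "has_bochner_integral lborel (\<lambda>x::real. exp (- x\<^sup>2) * x ^ k) (gauss_moment k)"
proof (cases "even k")
  case True
  then obtain m where m: "k = 2 * m" by (auto elim: evenE)
  show ?thesis
    using has_bochner_integral_even_function[OF gaussian_moment_even_pos[where k=m]]
    by (simp add: m gauss_moment_def)
next
  case False
  then obtain m where m: "k = 2 * m + 1" by (auto elim: oddE)
  show ?thesis
    using has_bochner_integral_odd_function[OF gaussian_moment_odd_pos[where k=m]]
    by (simp add: m gauss_moment_def)
qed

lemma gauss_moment_Suc_0 [simp]: "gauss_moment (Suc 0) = 0"
  by (simp add: gauss_moment_def)

lemma gauss_moment_plus2: "gauss_moment (Suc (Suc k)) = (k + 1) / 2 * gauss_moment k"
proof (cases "even k")
  case True
  then obtain m where m: "k = 2 * m" by (auto elim: evenE)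
  \<comment> \<open>The factor k + 2 = 2c in (k+2)! cancels against the factor c = m + 1 in
    (m+1)!.\<close>
  define c where "c = real m + 1"
  have "c \<noteq> 0" "real k = 2 * c - 2" by (simp_all add: c_def m)
  moreover have "fact (Suc (Suc k)) = (real k + 2) * ((real k + 1) * fact k)"
    by (simp add: algebra_simps)
  moreover have "fact (Suc m) = c * fact m"
    by (simp add: c_def algebra_simps)
  moreover have "Suc (Suc k) div 2 = Suc m" "k div 2 = m"
    by (simp_all add: m)
  ultimately show ?thesis
    using True by (simp add: gauss_moment_def divide_simps del: fact_Suc)
qed (simp add: gauss_moment_def)

text \<open>Integration against exp(-x^2) as a functional on coefficients, so that linearity and
  integration by parts are finite algebra. \<open>has_bochner_integral_gauss_integral\<close> links
  it to the Lebesgue integral.\<close>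

definition gauss_integral :: "complex poly \<Rightarrow> complex" where
  "gauss_integral p = (\<Sum>k\<le>degree p. of_real (gauss_moment k) * coeff p k)"

lemma gauss_integral_bound:
  assumes "degree p \<le> N"
  shows "gauss_integral p = (\<Sum>k\<le>N. of_real (gauss_moment k) * coeff p k)"
  unfolding gauss_integral_def
  by (rule sum.mono_neutral_left) (use assms in \<open>auto simp: coeff_eq_0\<close>)

lemma gauss_integral_add: "gauss_integral (p + q) = gauss_integral p + gauss_integral q"
proof -
  define N where "N = max (degree p) (degree q)"
  have "degree (p + q) \<le> N" "degree p \<le> N" "degree q \<le> N"
    by (simp_all add: N_def degree_add_le_max)
  then show ?thesis
    by (simp add: gauss_integral_bound[of _ N] distrib_left sum.distrib)
qed

lemma gauss_integral_smult: "gauss_integral (smult c p) = c * gauss_integral p"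
  by (simp add: gauss_integral_bound[of _ "degree p"] sum_distrib_left mult_ac)

lemma gauss_integral_0 [simp]: "gauss_integral 0 = 0"
  by (simp add: gauss_integral_def)

lemma gauss_integral_diff: "gauss_integral (p - q) = gauss_integral p - gauss_integral q"
  using gauss_integral_add[of "p - q" q] by simp

lemma gauss_integral_minus: "gauss_integral (- q) = - gauss_integral q"
  using gauss_integral_diff[of 0 q] by simp

lemma gauss_integral_sum: "gauss_integral (sum f A) = (\<Sum>i\<in>A. gauss_integral (f i))"
  by (induction A rule: infinite_finite_induct) (auto simp: gauss_integral_add)

text \<open>Integration by parts, obtained from the moment recursion. Reindexing introduces one
  extra term, which vanishes because the first moment is 0.\<close>

lemma gauss_integral_pderiv: "gauss_integral (pderiv p) = 2 * gauss_integral ([:0, 1:] * p)"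
proof -
  define N where "N = degree p"
  have "gauss_integral (pderiv p) = (\<Sum>k\<le>N. of_real (gauss_moment k) * coeff (pderiv p) k)"
    by (rule gauss_integral_bound) (simp add: N_def degree_pderiv)
  also have "\<dots> = (\<Sum>k\<le>N. of_real (gauss_moment k) * (of_nat (Suc k) * coeff p (Suc k)))"
    by (simp add: coeff_pderiv)
  also have "\<dots> = (\<Sum>k\<le>N. 2 * (of_real (gauss_moment (Suc (Suc k))) * coeff p (Suc k)))"
    by (intro sum.cong refl) (simp add: gauss_moment_plus2 field_simps)
  also have "\<dots> = 2 * (\<Sum>k\<le>Suc N. of_real (gauss_moment (Suc k)) * coeff p k)"
    by (simp add: sum.atMost_Suc_shift sum_distrib_left del: sum.atMost_Suc)
  also have "(\<Sum>k\<le>Suc N. of_real (gauss_moment (Suc k)) * coeff p k) =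
      (\<Sum>k\<le>Suc (Suc N). of_real (gauss_moment k) * coeff ([:0, 1:] * p) k)"
    by (simp add: sum.atMost_Suc_shift del: sum.atMost_Suc)
  also have "\<dots> = gauss_integral ([:0, 1:] * p)"
    by (rule gauss_integral_bound[symmetric]) (auto simp: N_def degree_pCons_eq_if)
  finally show ?thesis .
qed

lemma has_bochner_integral_gauss_integral:
  fixes p :: "complex poly"
  shows "has_bochner_integral lborel (\<lambda>x. of_real (exp (- x\<^sup>2)) * poly p (of_real x)) (gauss_integral p)"
proof -
  have "has_bochner_integral lborel (\<lambda>x. \<Sum>k\<le>degree p. (exp (- x\<^sup>2) * x ^ k) *\<^sub>R coeff p k)
      (\<Sum>k\<le>degree p. gauss_moment k *\<^sub>R coeff p k)"
    by (intro has_bochner_integral_sum has_bochner_integral_scaleR_left has_bochner_integral_gauss_moment)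
  then show ?thesis
    by (simp add: gauss_integral_def poly_altdef scaleR_conv_of_real sum_distrib_left mult_ac)
qed

text \<open>A matrix is the finite sum of its entries placed by the bounded linear embeddings
  \<open>E i j\<close>.\<close>

lemma has_bochner_integral_matrixI:
  fixes M :: "real \<Rightarrow> complex^'n^'m"
  assumes "\<And>i j. has_bochner_integral \<mu> (\<lambda>x. M x $ i $ j) (I $ i $ j)"
  shows "has_bochner_integral \<mu> M I"
proof -
  define E :: "'m \<Rightarrow> 'n \<Rightarrow> complex \<Rightarrow> complex^'n^'m" where
    "E = (\<lambda>i j c. axis i (axis j c))"
  have bl: "bounded_linear (E i j)" for i j
    unfolding E_def linear_conv_bounded_linear[symmetric]
    by (simp add: linear_iff axis_def vec_eq_iff)
  have E_nth: "E k l c $ i $ j = (if k = i then (if l = j then c else 0) else 0)" for k l c i j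
    by (simp add: E_def axis_def)
  have "(\<Sum>l\<in>UNIV. if k = i then g l else 0) = (if k = i then sum g UNIV else 0)"
    for k i :: 'm and g :: "'n \<Rightarrow> complex" by simp
  then have decomp: "A = (\<Sum>i\<in>UNIV. \<Sum>j\<in>UNIV. E i j (A $ i $ j))" for A
    by (simp add: vec_eq_iff E_nth)
  have "has_bochner_integral \<mu> (\<lambda>x. \<Sum>i\<in>UNIV. \<Sum>j\<in>UNIV. E i j (M x $ i $ j))
     (\<Sum>i\<in>UNIV. \<Sum>j\<in>UNIV. E i j (I $ i $ j))"
    by (intro has_bochner_integral_sum has_bochner_integral_bounded_linear[OF bl] assms)
  then show ?thesis by (simp flip: decomp)
qed

text \<open>The integrand is exp(-x^2) times a sum of squared moduli. It vanishes almost everywhere,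
  whereas a nonzero r_k has only finitely many roots.\<close>

lemma gauss_integral_cnj_self_eq_0:
  assumes "finite A" "(\<Sum>k\<in>A. gauss_integral (r k * map_poly cnj (r k))) = 0" "k \<in> A"
  shows "r k = 0"
proof (rule ccontr)
  assume r0: "r k \<noteq> 0"
  define f where "f = (\<lambda>x::real. exp (- x\<^sup>2) * (\<Sum>k\<in>A. (cmod (poly (r k) (of_real x)))\<^sup>2))"
  have ev: "of_real (exp (- x\<^sup>2)) * poly (\<Sum>k\<in>A. r k * map_poly cnj (r k)) (of_real x) = complex_of_real (f x)" for x
    using poly_cnj[of _ "complex_of_real x"]
    by (simp add: f_def poly_sum complex_norm_square flip: of_real_power)
  have "has_bochner_integral lborel (\<lambda>x. complex_of_real (f x)) 0"
    using has_bochner_integral_gauss_integral[of "\<Sum>k\<in>A. r k * map_poly cnj (r k)"] assms(2)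
    by (simp add: ev gauss_integral_sum)
  note I = this[unfolded has_bochner_integral_iff]
  have "integrable lborel f"
    using integrable_Re[OF I[THEN conjunct1]] by simp
  moreover have "integral\<^sup>L lborel f = 0"
    using I[THEN conjunct2] by simp
  moreover have "f x \<ge> 0" for x by (simp add: f_def sum_nonneg)
  ultimately have "AE x in lborel. f x = 0"
    using integral_nonneg_eq_0_iff_AE[of lborel f] by simp
  moreover have "AE x in lborel. x \<notin> of_real -` {x. poly (r k) x = 0}"
    by (intro AE_not_in finite_imp_null_set_lborel finite_vimageI poly_roots_finite r0)
      (auto simp: inj_on_def)
  ultimately have "AE x in lborel :: real measure. False"
  proof eventually_elim
    case (elim x)
    then have "\<forall>k\<in>A. (cmod (poly (r k) (of_real x)))\<^sup>2 = 0"
      using assms(1) by (simp add: f_def sum_nonneg_eq_0_iff)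
    with elim assms(3) show False by auto
  qed
  then show False by (simp add: ae_filter_eq_bot_iff trivial_limit_def[symmetric])
qed

subsection \<open>Matrix polynomials filtered by degree\<close>

text \<open>The strict bound makes level 0 the zero space, the base of inductions on the
  degree.\<close>

definition degree_less :: "nat \<Rightarrow> (complex poly^'n^'n) set" where
  "degree_less n = {P. \<forall>i j k. n \<le> k \<longrightarrow> coeff (P $ i $ j) k = 0}"

definition mat_coeff :: "complex poly^'n^'n \<Rightarrow> nat \<Rightarrow> complex^'n^'n" where
  "mat_coeff P n = (\<chi> i j. coeff (P $ i $ j) n)"

lemma mat_coeff_nth [simp]: "mat_coeff P n $ i $ j = coeff (P $ i $ j) n"
  by (simp add: mat_coeff_def)

lemma coeff_mat_const_mult: "coeff ((mat_const C ** P) $ i $ j) k = (C ** mat_coeff P k) $ i $ j"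
  by (simp add: matrix_matrix_mult_def coeff_sum)

lemma mat_coeff_mat_const_mult [simp]: "mat_coeff (mat_const C ** P) n = C ** mat_coeff P n"
  by (simp add: vec_eq_iff coeff_mat_const_mult)

lemma mat_coeff_diff [simp]: "mat_coeff (P - Q) n = mat_coeff P n - mat_coeff Q n"
  by (simp add: vec_eq_iff)

lemma degree_less_0 [simp]: "degree_less 0 = {0}"
  by (auto simp: degree_less_def vec_eq_iff poly_eq_iff)

lemma degree_less_zero: "0 \<in> degree_less n"
    and degree_less_add: "P \<in> degree_less n \<Longrightarrow> Q \<in> degree_less n \<Longrightarrow> P + Q \<in> degree_less n"
    and degree_less_diff: "P \<in> degree_less n \<Longrightarrow> Q \<in> degree_less n \<Longrightarrow> P - Q \<in> degree_less n"
    and degree_less_mono: "P \<in> degree_less n \<Longrightarrow> n \<le> m \<Longrightarrow> P \<in> degree_less m"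
  by (auto simp: degree_less_def)

lemma degree_less_mat_const_mult: "P \<in> degree_less n \<Longrightarrow> mat_const C ** P \<in> degree_less n"
  unfolding degree_less_def mem_Collect_eq coeff_mat_const_mult
  by (simp add: matrix_matrix_mult_def)

lemma degree_less_Suc_iff: "P \<in> degree_less n \<longleftrightarrow> P \<in> degree_less (Suc n) \<and> mat_coeff P n = 0"
proof -
  have "n \<le> k \<longleftrightarrow> Suc n \<le> k \<or> k = n" for k by linarith
  then show ?thesis by (auto simp: degree_less_def vec_eq_iff)
qed

lemma monic_of_degree_iff:
  "monic_of_degree n P \<longleftrightarrow> P \<in> degree_less (Suc n) \<and> mat_coeff P n = mat 1"
proof -
  have "degree p \<le> n \<longleftrightarrow> (\<forall>k\<ge>Suc n. coeff p k = 0)" for p :: "complex poly"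
    by (auto simp: Suc_le_eq coeff_eq_0 intro!: degree_le)
  then show ?thesis
    by (auto simp: monic_of_degree_def mat_coeff_def degree_less_def)
qed

lemma ex_degree_less: "\<exists>n. P \<in> degree_less n"
proof -
  define n where "n = Suc (\<Sum>i\<in>UNIV. \<Sum>j\<in>UNIV. degree (P $ i $ j))"
  have "degree (P $ i $ j) < n" for i j
  proof -
    have "degree (P $ i $ j) \<le> (\<Sum>j\<in>UNIV. degree (P $ i $ j))"
      by (rule member_le_sum) auto
    also have "\<dots> \<le> (\<Sum>i\<in>UNIV. \<Sum>j\<in>UNIV. degree (P $ i $ j))"
      by (rule member_le_sum[where f = "\<lambda>i. \<Sum>j\<in>UNIV. degree (P $ i $ j)"]) auto
    finally show ?thesis by (simp add: n_def)
  qed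
  then have "P \<in> degree_less n"
    by (auto simp: degree_less_def intro!: coeff_eq_0 intro: less_le_trans)
  then show ?thesis ..
qed

section \<open>Constant left factors and operators determined on a basis\<close>

lemma mat_const_mult: "mat_const (A ** B) = mat_const A ** mat_const B"
  by (auto simp: vec_eq_iff matrix_matrix_mult_def poly_eq_iff coeff_sum coeff_pCons mult.commute split: nat.split)
  
lemma mat_const_1 [simp]: "mat_const (mat 1) = mat 1"
  by (simp add: vec_eq_iff mat_def)

lemma mat_const_add: "mat_const (A + B) = mat_const A + mat_const B"
  by (simp add: vec_eq_iff)

lemma mat_deriv_mat_const_mult: "mat_deriv (mat_const C ** P) = mat_const C ** mat_deriv P"
  by (simp add: mat_deriv_mult) (simp add: vec_eq_iff matrix_matrix_mult_def pderiv_pCons)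

lemma dact_mat_const_mult:
  fixes C :: "complex^'n^'n"
  shows "(mat_const C ** P) \<bullet>\<^sub>D D = mat_const C ** (P \<bullet>\<^sub>D D)"
proof -
  have "(mat_deriv ^^ i) (mat_const C ** P) = mat_const C ** (mat_deriv ^^ i) P" for i
    by (induction i) (simp_all add: mat_deriv_mat_const_mult)
  moreover have "mat_const C ** sum f A = (\<Sum>i\<in>A. mat_const C ** f i)" for f :: "nat \<Rightarrow> complex poly^'n^'n" and A
    by (induction A rule: infinite_finite_induct) (auto simp: matrix_add_ldistrib)
  ultimately show ?thesis
    by (simp add: dact_def matrix_mul_assoc)
qed

lemma dact_mult: "P \<bullet>\<^sub>D (D * E) = (P \<bullet>\<^sub>D D) \<bullet>\<^sub>D E"
  by (simp add: times_diffop_def dact_times)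

lemma dact_1: "P \<bullet>\<^sub>D 1 = P"
  by (simp add: one_diffop_def dact_dterm)

lemma dact_diff_left: "(P - Q) \<bullet>\<^sub>D D = P \<bullet>\<^sub>D D - Q \<bullet>\<^sub>D D"
  using dact_add_left[of "P - Q" Q D] by simp

lemma dact_0_left [simp]: "0 \<bullet>\<^sub>D D = 0"
  using dact_diff_left[of 0 0 D] by simp

lemma dact_dscale:
  fixes D :: "'n::finite diffop"
  shows "P \<bullet>\<^sub>D (c *\<^sub>D D) = mat_smult c (P \<bullet>\<^sub>D D)"
proof -
  have s: "mat_smult c (sum f A) = (\<Sum>i\<in>A. mat_smult c (f i))" for f :: "nat \<Rightarrow> complex poly^'n^'n" and A
    by (induction A rule: infinite_finite_induct) (auto simp: mat_smult_add_right)
  have "degree (symbol (c *\<^sub>D D)) \<le> degree (symbol D)"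
    by (intro degree_le) (simp add: dscale_def coeff_map_poly coeff_eq_0)
  from dact_bound[OF this] show ?thesis
    by (simp add: dact_def s dscale_def coeff_map_poly mat_smult_mult_right)
qed

text \<open>Invertible leading coefficients make F a basis over constant left factors: subtracting
  (leading coefficient of P)(inverse of that of F_n) F_n lowers the degree. Only F_m with m < n are
  used, which orthogonality and degree arguments rely on.\<close>

lemma degree_less_induct:
  assumes F: "\<And>m. F m \<in> degree_less (Suc m)" "\<And>m. invertible (mat_coeff (F m) m)"
    and P: "P \<in> degree_less n"
    and step: "R 0" "\<And>P Q. R P \<Longrightarrow> R Q \<Longrightarrow> R (P + Q)" "\<And>C m. m < n \<Longrightarrow> R (mat_const C ** F m)"
  shows "R P"
  using P step(3)
proof (induction n arbitrary: P)
  case 0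
  then show ?case using step(1) by simp
next
  case (Suc n)
  obtain B where B: "B ** mat_coeff (F n) n = mat 1"
    using F(2)[of n] by (auto simp: invertible_def)
  define C where "C = mat_const (mat_coeff P n ** B)"
  have "mat_coeff (P - C ** F n) n = 0"
    by (simp add: C_def B flip: matrix_mul_assoc)
  moreover have "P - C ** F n \<in> degree_less (Suc n)"
    unfolding C_def by (intro degree_less_diff degree_less_mat_const_mult Suc.prems F)
  ultimately have "P - C ** F n \<in> degree_less n"
    by (subst degree_less_Suc_iff) simp
  then have "R (P - C ** F n)" using Suc by auto
  moreover have "R (C ** F n)" unfolding C_def using Suc.prems by blast
  ultimately have "R (P - C ** F n + C ** F n)" by (rule step(2))
  then show ?case by simp
qed

text \<open>Operators act on the right and so commute with constant left factors; their values on a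
  basis determine them.\<close>

lemma dact_eq_0_on_basis:
  fixes D :: "'n::finite diffop"
  assumes F: "\<And>m. F m \<in> degree_less (Suc m)" "\<And>m. invertible (mat_coeff (F m) m)"
    and D: "\<And>m. F m \<bullet>\<^sub>D D = 0"
  shows "D = 0"
proof (rule dact_eq_0)
  fix P :: "complex poly^'n^'n"
  obtain n where "P \<in> degree_less n" using ex_degree_less by blast
  then show "P \<bullet>\<^sub>D D = 0"
    by (rule degree_less_induct[OF F]) (simp_all add: dact_add_left dact_mat_const_mult D)
qed

lemma dact_eqI_on_basis:
  fixes D :: "'n::finite diffop"
  assumes F: "\<And>m. F m \<in> degree_less (Suc m)" "\<And>m. invertible (mat_coeff (F m) m)"
    and D: "\<And>m. F m \<bullet>\<^sub>D D = F m \<bullet>\<^sub>D E"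
  shows "D = E"
  using dact_eq_0_on_basis[OF F, of "D - E"] D by (simp add: dact_diff_right)

lemma mat_const_mult_cancel:
  assumes "invertible (mat_coeff P m)" "mat_const A ** P = mat_const B ** P"
  shows "A = B"
proof -
  obtain C where C: "mat_coeff P m ** C = mat 1"
    using assms(1) by (auto simp: invertible_def)
  have "A ** mat_coeff P m = B ** mat_coeff P m"
    using arg_cong[OF assms(2), of "\<lambda>Q. mat_coeff Q m"] by simp
  then have "A ** (mat_coeff P m ** C) = B ** (mat_coeff P m ** C)"
    by (simp add: matrix_mul_assoc)
  then show ?thesis by (simp add: C)
qed

lemma hermite_rows_degree: "hermite_rows a n \<in> degree_less (Suc n)"
proof -
  have "coeff (hermite n) k = 0" "coeff (pderiv (pderiv (hermite n))) k = 0"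
     "coeff ([:0, 1:] * pderiv (hermite n)) k = 0" "coeff ([:0,0,1:] * pderiv (pderiv (hermite n))) k = 0"
    if "Suc n \<le> k" for k
    using that by (simp_all only: coeff_X_pderiv coeff_X2_pderiv2) (simp_all add: coeff_pderiv coeff_hermite)
  then show ?thesis
    unfolding degree_less_def hermite_rows_alt Let_def mem_Collect_eq forall_2 mat2_nth coeff_diff coeff_minus coeff_smult
    by simp
qed

text \<open>For real a the number is at least 1, since n(n-1) is nonnegative for natural n.\<close>

lemma hermite_rows_norm_nonzero: "1 + (complex_of_real a)^2 * of_nat n * (of_nat n - 1) / 4 \<noteq> 0"
proof -
  have "0 \<le> real n * (real n - 1)" by (cases n) auto
  then have "1 + a^2 * (real n * (real n - 1)) / 4 > 0"
    by (simp add: add_pos_nonneg)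
  moreover have "1 + (complex_of_real a)^2 * of_nat n * (of_nat n - 1) / 4 =
     of_real (1 + a^2 * (real n * (real n - 1)) / 4)"
    by simp
  ultimately show ?thesis by (metis of_real_eq_0_iff less_irrefl)
qed

text \<open>The leading coefficient is upper triangular, because h_n'' has degree below n, and its
  diagonal is 1 and -(1 + a^2 n(n-1)/4).\<close>

lemma hermite_rows_lead_invertible: "invertible (mat_coeff (hermite_rows (of_real a) n) n)"
proof -
  have "det (mat_coeff (hermite_rows (of_real a) n) n) = - (1 + (complex_of_real a)^2 * of_nat n * (of_nat n - 1) / 4)"
    unfolding det_2 mat_coeff_nth hermite_rows_alt Let_def mat2_nth coeff_diff coeff_minus coeff_smult
       coeff_X_pderiv coeff_X2_pderiv2
    by (simp add: coeff_pderiv coeff_hermite)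
  then show ?thesis using hermite_rows_norm_nonzero[of a n] by (metis invertible_det_nz neg_equal_0_iff_equal)
qed

subsection \<open>The inner product\<close>

text \<open>Conjugating coefficients agrees with conjugating values at real points, so adjoints stay
  inside polynomial matrices.\<close>

definition mat_adjoint :: "complex poly^'n^'m \<Rightarrow> complex poly^'m^'n" where
  "mat_adjoint P = (\<chi> i j. map_poly cnj (P $ j $ i))"

definition mat_gauss :: "complex poly^'n^'m \<Rightarrow> complex^'n^'m" where
  "mat_gauss P = (\<chi> i j. gauss_integral (P $ i $ j))"

text \<open>The unipotent factor T of the weight.\<close>

definition weight_factor :: "complex \<Rightarrow> complex poly^2^2" where
  "weight_factor a = mat2 1 [:0, 0, a:] 0 1"

lemma cnj_poly_hom:
  "map_poly cnj (p + q) = map_poly cnj p + map_poly cnj q"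
  "map_poly cnj (p - q) = map_poly cnj p - map_poly cnj q"
  "map_poly cnj (- p) = - map_poly cnj p"
  "map_poly cnj (smult c p) = smult (cnj c) (map_poly cnj p)"
  "map_poly cnj (pderiv p) = pderiv (map_poly cnj p)"
  by (simp_all add: poly_eq_iff coeff_map_poly coeff_pderiv)

lemma cnj_poly_mult: "map_poly cnj (p * q) = map_poly cnj p * map_poly cnj q"
  by (simp add: poly_eq_iff coeff_map_poly coeff_mult)

lemma cnj_poly_sum: "map_poly cnj (sum f A) = (\<Sum>i\<in>A. map_poly cnj (f i))"
  by (induction A rule: infinite_finite_induct) (auto simp: cnj_poly_hom)

lemma cnj_hermite [simp]: "map_poly cnj (hermite n) = hermite n"
  by (induction n) (simp_all add: cnj_poly_hom map_poly_pCons)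

lemma mat_adjoint_nth [simp]: "mat_adjoint P $ i $ j = map_poly cnj (P $ j $ i)"
  by (simp add: mat_adjoint_def)

lemma mat_gauss_nth [simp]: "mat_gauss P $ i $ j = gauss_integral (P $ i $ j)"
  by (simp add: mat_gauss_def)

lemma mat_adjoint_add: "mat_adjoint (P + Q) = mat_adjoint P + mat_adjoint Q"
  by (simp add: vec_eq_iff cnj_poly_hom)

lemma mat_adjoint_mult: "mat_adjoint (P ** Q) = mat_adjoint Q ** mat_adjoint P"
  by (simp add: vec_eq_iff matrix_matrix_mult_def cnj_poly_sum cnj_poly_mult mult.commute)

lemma mat_adjoint_const: "mat_adjoint (mat_const C) = mat_const (conj_transpose C)"
  by (simp add: vec_eq_iff conj_transpose_def map_poly_pCons)

lemma mat_gauss_add: "mat_gauss (P + Q) = mat_gauss P + mat_gauss Q"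
  by (simp add: vec_eq_iff gauss_integral_add)

lemma mat_gauss_const_left: "mat_gauss (mat_const C ** P) = C ** mat_gauss P"
  and mat_gauss_const_right: "mat_gauss (P ** mat_const B) = mat_gauss P ** B"
  by (simp_all add: vec_eq_iff matrix_matrix_mult_def gauss_integral_sum gauss_integral_smult mult.commute)

definition gauss_inner :: "complex \<Rightarrow> complex poly^2^2 \<Rightarrow> complex poly^2^2 \<Rightarrow> complex^2^2" where
  "gauss_inner a P Q = mat_gauss (P ** weight_factor a ** mat_adjoint (Q ** weight_factor a))"

text \<open>With W written through T and its adjoint, each entry of the integrand is exp(-x^2) times
  a polynomial.\<close>

lemma weight_inner_W: "weight_inner (-\<infinity>) \<infinity> (W a) P Q = gauss_inner (of_real a) P Q"
proof -
  have c: "cnj (poly p (complex_of_real x)) = poly (map_poly cnj p) (complex_of_real x)" for p x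
    using poly_cnj[of p "of_real x"] by simp
  have W: "W a x = (\<chi> i j. of_real (exp (- x\<^sup>2)) * (mat_eval (weight_factor a) x ** conj_transpose (mat_eval (weight_factor a) x)) $ i $ j)" for x
    by (rule mat2_eqI) (simp_all add: W_def Let_def mult2_nth mat_eval_def conj_transpose_def weight_factor_def algebra_simps power2_eq_square power4_eq_xxxx)
  have "(mat_eval P x ** W a x ** conj_transpose (mat_eval Q x)) $ i $ j =
     of_real (exp (- x\<^sup>2)) * poly ((P ** weight_factor a ** mat_adjoint (Q ** weight_factor a)) $ i $ j) (of_real x)" for x i j
    unfolding W
    by (simp add: mult2_nth mat_eval_def conj_transpose_def cnj_poly_hom cnj_poly_mult flip: c)
       (simp only: distrib_left distrib_right mult_ac add_ac)
  then have "has_bochner_integral lborel (\<lambda>x. mat_eval P x ** W a x ** conj_transpose (mat_eval Q x)) (gauss_inner a P Q)"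
    by (intro has_bochner_integral_matrixI) (simp add: gauss_inner_def has_bochner_integral_gauss_integral)
  then show ?thesis
    by (simp add: weight_inner_def interval_lebesgue_integral_def set_lebesgue_integral_def has_bochner_integral_integral_eq)
qed

lemma gauss_inner_add_right: "gauss_inner a P (Q + R) = gauss_inner a P Q + gauss_inner a P R"
  by (simp add: gauss_inner_def mat_mult_add_left matrix_add_ldistrib mat_adjoint_add mat_gauss_add)

lemma gauss_inner_diff_left: "gauss_inner a (P - Q) R = gauss_inner a P R - gauss_inner a Q R"
proof -
  have "gauss_inner a (A + B) R = gauss_inner a A R + gauss_inner a B R" for A B
    by (simp add: gauss_inner_def mat_mult_add_left mat_gauss_add)
  from this[of "P - Q" Q] show ?thesis by simp
qed

lemma gauss_inner_const_left: "gauss_inner a (mat_const C ** P) Q = C ** gauss_inner a P Q"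
  by (simp add: gauss_inner_def mat_gauss_const_left flip: matrix_mul_assoc)

lemma gauss_inner_const_right: "gauss_inner a P (mat_const C ** Q) = gauss_inner a P Q ** conj_transpose C"
  by (simp add: gauss_inner_def mat_gauss_const_right mat_adjoint_mult mat_adjoint_const matrix_mul_assoc)

text \<open>The i-th diagonal entry is the sum of the squared norms of the entries in row i of P T.
  Hence P T = 0, and T is unipotent.\<close>

lemma gauss_inner_self_eq_0:
  assumes "gauss_inner a P P = 0"
  shows "P = 0"
proof -
  have eq: "(P ** weight_factor a) $ i $ k = 0" for i k
  proof (rule gauss_integral_cnj_self_eq_0[where A = UNIV and r = "\<lambda>k. (P ** weight_factor a) $ i $ k"])
    have "gauss_inner a P P $ i $ i = 0" using assms by simp
    then show "(\<Sum>k\<in>UNIV. gauss_integral ((P ** weight_factor a) $ i $ k * map_poly cnj ((P ** weight_factor a) $ i $ k))) = 0"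
      unfolding gauss_inner_def mat_gauss_nth matrix_matrix_mult_def[of "P ** weight_factor a"]
      by (simp add: gauss_integral_sum)
  qed auto
  have 1: "P $ i $ 1 = 0" for i
    using eq[of i 1] unfolding mult2_nth weight_factor_def mat2_nth by simp
  have "P $ i $ 2 = 0" for i
    using eq[of i 2] unfolding mult2_nth weight_factor_def mat2_nth 1 by simp
  with 1 show "P = 0"
    by (simp add: vec_eq_iff forall_2)
qed

text \<open>The difference of the two n-th terms has degree below n and, by induction, is orthogonal
  to all earlier terms, hence to itself.\<close>

lemma monic_orthogonal_unique:
  assumes "is_monic_orthogonal (-\<infinity>) \<infinity> (W a) P" "is_monic_orthogonal (-\<infinity>) \<infinity> (W a) Q"
  shows "P = Q"
proof
  fix n show "P n = Q n"
  proof (induction n rule: less_induct)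
    case (less n)
    have P: "P m \<in> degree_less (Suc m)" "mat_coeff (P m) m = mat 1"
      and Q: "Q m \<in> degree_less (Suc m)" "mat_coeff (Q m) m = mat 1" for m
      using assms by (auto simp: is_monic_orthogonal_def monic_of_degree_iff)
    have inv: "invertible (mat_coeff (P m) m)" for m
      unfolding P(2) invertible_def by (rule exI[of _ "mat 1"]) simp
    let ?R = "P n - Q n"
    have R: "?R \<in> degree_less n"
      by (subst degree_less_Suc_iff) (simp add: degree_less_diff P Q)
    have "gauss_inner a ?R (P m) = 0" if "m < n" for m
    proof -
      have "gauss_inner a (P n) (P m) = 0" "gauss_inner a (Q n) (Q m) = 0"
        using assms that by (auto simp: is_monic_orthogonal_def weight_inner_W)
      then show ?thesis using less[OF that] by (simp add: gauss_inner_diff_left)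
    qed
    then have "gauss_inner a ?R (mat_const C ** P m) = 0" if "m < n" for m C
      using that by (simp add: gauss_inner_const_right)
    moreover have "gauss_inner a ?R 0 = 0"
      using gauss_inner_add_right[of a ?R 0 0] by simp
    ultimately have "gauss_inner a ?R ?R = 0"
      by - (rule degree_less_induct[of P, OF P(1) inv R], simp_all add: gauss_inner_add_right)
    then have "?R = 0" by (rule gauss_inner_self_eq_0)
    then show ?case by simp
  qed
qed

subsection \<open>Orthogonality\<close>

text \<open>Integration by parts for h_n q: the raising operator moves onto q as half the
  derivative.\<close>

lemma gauss_integral_hermite_Suc:
  "gauss_integral (hermite (Suc n) * q) = gauss_integral (hermite n * pderiv q) / 2"
proof -
  have "gauss_integral (pderiv (hermite n * q)) = 2 * gauss_integral ([:0, 1:] * (hermite n * q))"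
    by (rule gauss_integral_pderiv)
  then have "gauss_integral (hermite n * pderiv q) + gauss_integral (q * pderiv (hermite n)) =
      2 * gauss_integral ([:0, 1:] * (hermite n * q))"
    by (simp only: pderiv_mult gauss_integral_add)
  moreover
  have "hermite (Suc n) * q = [:0, 1:] * (hermite n * q) - smult (1/2) (q * pderiv (hermite n))"
    by (rule iffD1[OF poly_eq_poly_eq_iff], rule ext) (simp add: algebra_simps)
  then have "gauss_integral (hermite (Suc n) * q) =
      gauss_integral ([:0, 1:] * (hermite n * q)) - 1/2 * gauss_integral (q * pderiv (hermite n))"
    by (simp only: gauss_integral_diff gauss_integral_smult)
  moreover have "w = x / 2" if "x + y = 2 * z" "w = z - 1/2 * y" for w x y z :: complex
    using that by (simp add: eq_diff_eq[symmetric] diff_divide_distrib)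
  ultimately show ?thesis by blast
qed

lemma gauss_integral_hermite_plus2:
  "gauss_integral (hermite (Suc (Suc n)) * q) = gauss_integral (hermite n * pderiv (pderiv q)) / 4"
  by (simp add: gauss_integral_hermite_Suc del: hermite.simps)

text \<open>After n integrations by parts h_n has become 1. Orthogonality follows, since the n-th
  derivative kills lower degrees.\<close>

lemma gauss_integral_hermite: "gauss_integral (hermite n * q) = gauss_integral ((pderiv ^^ n) q) / 2 ^ n"
  by (induction n arbitrary: q) (simp_all add: gauss_integral_hermite_Suc funpow_Suc_right del: hermite.simps(2) funpow.simps(2))

lemma higher_pderiv_eq_0:
  fixes p :: "complex poly"
  assumes "degree p < n"
  shows "(pderiv ^^ n) p = 0"
proof -
  obtain m where m: "n = Suc m" "degree p \<le> m" using assms by (cases n) auto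
  then have "degree ((pderiv ^^ m) p) = 0" by (simp add: degree_higher_pderiv)
  then show ?thesis by (simp add: m pderiv_eq_0_iff)
qed

lemma gauss_integral_hermite_orthogonal:
  assumes "n \<noteq> m"
  shows "gauss_integral (hermite n * hermite m) = 0"
proof -
  have *: "gauss_integral (hermite n * hermite m) = 0" if "m < n" for n m
    using degree_hermite_le[of m] that
    by (simp add: gauss_integral_hermite higher_pderiv_eq_0)
  show ?thesis
    using assms *[of n m] *[of m n] by (cases "n < m") (auto simp: mult.commute)
qed

text \<open>For n = k + 2 the first factor is a multiple of h_k, and integrating h_k h_m'' gives 4
  times the integral of h_(k+2) h_m.\<close>

lemma gauss_integral_hermite_pderiv2_orthogonal:
  assumes "n \<noteq> m"
  shows "gauss_integral (pderiv (pderiv (hermite n)) * pderiv (pderiv (hermite m))) = 0"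
proof -
  consider "n = 0" | "n = 1" | k where "n = Suc (Suc k)" by (metis One_nat_def not0_implies_Suc)
  then show ?thesis
  proof cases
    case (3 k)
    have "gauss_integral (hermite k * pderiv (pderiv (hermite m))) = 0"
      using gauss_integral_hermite_plus2[of k "hermite m"] gauss_integral_hermite_orthogonal[OF assms] 3
      by simp
    then show ?thesis
      by (simp add: 3 pderiv_hermite_Suc pderiv_smult gauss_integral_smult del: hermite.simps)
  qed (simp_all add: pderiv_pCons)
qed

lemma hermite_rows_mult_weight_factor: "hermite_rows a n ** weight_factor a =
   (let h = hermite n in mat2 h (smult a (hermite (Suc (Suc n)))) (smult (a/4) (pderiv (pderiv h))) (- h))"
  by (rule mat2_eqI) (simp_all add: mult2_nth hermite_rows_def weight_factor_def Let_def smult_diff_right algebra_simps del: hermite.simps)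

text \<open>The mixed entries, v_n against u_m and u_n against v_m, cancel because integrating
  h_(n+2) h_m gives a quarter of the integral of h_n h_m''. This fixes the constant a/4 in
  u_n.\<close>

lemma gauss_inner_hermite_rows:
  assumes "n \<noteq> m"
  shows "gauss_inner (of_real a) (hermite_rows (of_real a) n) (hermite_rows (of_real a) m) = 0"
proof -
  have o: "gauss_integral (hermite n * hermite m) = 0"
    "gauss_integral (hermite (Suc (Suc n)) * hermite (Suc (Suc m))) = 0"
    "gauss_integral (pderiv (pderiv (hermite n)) * pderiv (pderiv (hermite m))) = 0"
    using assms by (simp_all add: gauss_integral_hermite_orthogonal gauss_integral_hermite_pderiv2_orthogonal del: hermite.simps)
  have c: "gauss_integral (hermite n * hermite (Suc (Suc m))) = gauss_integral (pderiv (pderiv (hermite n)) * hermite m) / 4"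
    using gauss_integral_hermite_plus2[of m "hermite n"] by (simp add: mult.commute del: hermite.simps)
  show ?thesis
    unfolding gauss_inner_def hermite_rows_mult_weight_factor Let_def
    by (rule mat2_eqI; simp add: mult2_nth cnj_poly_hom gauss_integral_add gauss_integral_diff gauss_integral_smult gauss_integral_minus
       o c del: hermite.simps; simp add: gauss_integral_hermite_plus2 del: hermite.simps)
qed

lemma matrix_inv_left: "invertible A \<Longrightarrow> matrix_inv A ** A = mat 1"
  unfolding matrix_inv_def invertible_def by (rule someI2_ex) auto

text \<open>Dividing by the leading coefficient on the left makes the rows monic and keeps them
  orthogonal; uniqueness then evaluates the definite description.\<close>

lemma monic_orthogonal_W:
  "monic_orthogonal (-\<infinity>) \<infinity> (W a) n =
     mat_const (matrix_inv (mat_coeff (hermite_rows (of_real a) n) n)) ** hermite_rows (of_real a) n"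
proof -
  define P where "P = (\<lambda>n. mat_const (matrix_inv (mat_coeff (hermite_rows (of_real a) n) n)) ** hermite_rows (of_real a) n)"
  have "is_monic_orthogonal (-\<infinity>) \<infinity> (W a) P"
    unfolding is_monic_orthogonal_def monic_of_degree_iff weight_inner_W P_def
    by (intro conjI allI impI; simp only: gauss_inner_const_left gauss_inner_const_right gauss_inner_hermite_rows
         mat_coeff_mat_const_mult matrix_inv_left[OF hermite_rows_lead_invertible] degree_less_mat_const_mult[OF hermite_rows_degree])
       (simp add: gauss_inner_hermite_rows)
  then have "monic_orthogonal (-\<infinity>) \<infinity> (W a) = P"
    unfolding monic_orthogonal_def using monic_orthogonal_unique by blast
  then show ?thesis by (simp add: P_def)
qed

subsection \<open>Joint eigenvalues\<close>

text \<open>The normalising factor only conjugates the eigenvalue matrix, so membership can be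
  tested on the unnormalised rows.\<close>

lemma weight_algebra_W_iff:
  "D \<in> weight_algebra (-\<infinity>) \<infinity> (W a) \<longleftrightarrow>
     (\<forall>n. \<exists>\<Lambda>. hermite_rows (of_real a) n \<bullet>\<^sub>D D = mat_const \<Lambda> ** hermite_rows (of_real a) n)"
proof -
  have "(\<exists>\<Lambda>. mat_const (matrix_inv L) ** (P \<bullet>\<^sub>D D) = mat_const \<Lambda> ** (mat_const (matrix_inv L) ** P)) \<longleftrightarrow>
     (\<exists>\<Lambda>. P \<bullet>\<^sub>D D = mat_const \<Lambda> ** P)" (is "?l = ?r")
    if L: "L ** matrix_inv L = mat 1" "matrix_inv L ** L = mat 1" for L and P :: "complex poly^2^2"
  proof
    assume ?l
    then obtain \<Lambda> where "mat_const (matrix_inv L) ** (P \<bullet>\<^sub>D D) = mat_const \<Lambda> ** (mat_const (matrix_inv L) ** P)" ..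
    then have "mat_const L ** (mat_const (matrix_inv L) ** (P \<bullet>\<^sub>D D)) = mat_const L ** (mat_const \<Lambda> ** (mat_const (matrix_inv L) ** P))"
      by simp
    then have "mat_const (L ** matrix_inv L) ** (P \<bullet>\<^sub>D D) = mat_const (L ** \<Lambda> ** matrix_inv L) ** P"
      by (simp only: matrix_mul_assoc mat_const_mult)
    then show ?r unfolding L by auto
  next
    assume ?r
    then obtain \<Lambda> where "P \<bullet>\<^sub>D D = mat_const \<Lambda> ** P" ..
    then have "mat_const (matrix_inv L) ** (P \<bullet>\<^sub>D D) = mat_const (matrix_inv L ** \<Lambda> ** (L ** matrix_inv L)) ** P"
      unfolding L by (simp add: mat_const_mult matrix_mul_assoc)
    then have "mat_const (matrix_inv L) ** (P \<bullet>\<^sub>D D) = mat_const (matrix_inv L ** \<Lambda> ** L) ** (mat_const (matrix_inv L) ** P)"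
      by (simp only: matrix_mul_assoc mat_const_mult)
    then show ?l ..
  qed
  moreover have "mat_coeff (hermite_rows (of_real a) n) n ** matrix_inv (mat_coeff (hermite_rows (of_real a) n) n) = mat 1" for n
    using matrix_inv_left[OF hermite_rows_lead_invertible[of a n]] by (simp add: matrix_left_right_inverse)
  ultimately show ?thesis
    by (simp add: weight_algebra_def monic_orthogonal_W dact_mat_const_mult matrix_inv_left hermite_rows_lead_invertible)
qed

text \<open>The numbers p and q are the eigenvalues on the rows coming from v_n and u_n.\<close>

definition diag_eigen :: "complex \<Rightarrow> nat \<Rightarrow> 2 diffop \<Rightarrow> complex \<Rightarrow> complex \<Rightarrow> bool" where
  "diag_eigen a n D p q \<longleftrightarrow> hermite_rows a n \<bullet>\<^sub>D D = mat_const (mat2 p 0 0 q) ** hermite_rows a n"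

lemma diag_eigen_1: "diag_eigen a n 1 1 1"
proof -
  have "(mat2 1 0 0 1 :: complex^2^2) = mat 1" by (rule mat2_eqI) (simp_all add: mat_def)
  then show ?thesis by (simp add: diag_eigen_def dact_1)
qed

lemma diag_eigen_add:
  assumes "diag_eigen a n D p q" "diag_eigen a n E r s"
  shows "diag_eigen a n (D + E) (p + r) (q + s)"
proof -
  have "mat2 (p + r) 0 0 (q + s) = mat2 p 0 0 q + mat2 r 0 0 s" by (rule mat2_eqI) simp_all
  then show ?thesis
    using assms by (simp add: diag_eigen_def dact_add_right mat_const_add mat_mult_add_left)
qed

lemma diag_eigen_scale:
  assumes "diag_eigen a n D p q"
  shows "diag_eigen a n (c *\<^sub>D D) (c * p) (c * q)"
proof -
  have "mat_const (mat2 (c * p) 0 0 (c * q)) = mat_smult c (mat_const (mat2 p 0 0 q))"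
    by (rule mat2_eqI) (simp_all add: mat_smult_def)
  then show ?thesis
    using assms by (simp add: diag_eigen_def dact_dscale mat_smult_mult_left)
qed

lemma diag_eigen_diff:
  assumes "diag_eigen a n D p q" "diag_eigen a n E r s"
  shows "diag_eigen a n (D - E) (p - r) (q - s)"
proof -
  have "mat2 (p - r) 0 0 (q - s) + mat2 r 0 0 s = mat2 p 0 0 q" by (rule mat2_eqI) simp_all
  then have "mat_const (mat2 (p - r) 0 0 (q - s)) ** hermite_rows a n + mat_const (mat2 r 0 0 s) ** hermite_rows a n = mat_const (mat2 p 0 0 q) ** hermite_rows a n"
    by (simp flip: mat_const_add mat_mult_add_left)
  then show ?thesis
    using assms by (simp add: diag_eigen_def dact_diff_right eq_diff_eq[symmetric])
qed

lemma dact_mult_eigen: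
  assumes "P \<bullet>\<^sub>D D = mat_const A ** P" "P \<bullet>\<^sub>D E = mat_const B ** P"
  shows "P \<bullet>\<^sub>D (D * E) = mat_const (A ** B) ** P"
  using assms by (simp add: dact_mult dact_mat_const_mult mat_const_mult matrix_mul_assoc)

lemma mat2_mult:
  "(mat2 p q r s :: 'a::semiring_1^2^2) ** mat2 p' q' r' s' =
     mat2 (p * p' + q * r') (p * q' + q * s') (r * p' + s * r') (r * q' + s * s')"
  by (rule mat2_eqI) (simp_all add: mult2_nth)

lemma diag_eigen_mult:
  assumes "diag_eigen a n D p q" "diag_eigen a n E r s"
  shows "diag_eigen a n (D * E) (p * r) (q * s)"
  using dact_mult_eigen[of "hermite_rows a n"] assms by (simp add: diag_eigen_def mat2_mult)

lemma diag_eigen_power: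
  assumes "diag_eigen a n D p q"
  shows "diag_eigen a n (D ^ k) (p ^ k) (q ^ k)"
  by (induction k) (simp_all add: diag_eigen_1 diag_eigen_mult assms)

definition scalar_eigen :: "complex \<Rightarrow> 2 diffop \<Rightarrow> complex poly \<Rightarrow> bool" where
  "scalar_eigen a D z \<longleftrightarrow> (\<forall>n. diag_eigen a n D (poly z (of_nat n)) (poly z (of_nat n)))"

section \<open>Eigenvalues of Z_1, Z_2, Z_3, of degrees 3, 4, 5 in n\<close>

context
  fixes a :: complex
  assumes a0: "a \<noteq> 0"
begin

lemma diag_eigen_D1: "diag_eigen a n (D1 a) (- 2 * of_nat n) (4 - 2 * of_nat n)"
  unfolding diag_eigen_def by (rule hermite_rows_D1[OF a0])

lemma diag_eigen_D3: "diag_eigen a n (D3 a) 0 (16 / a^2 + 4 * of_nat n * (of_nat n - 1))"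
  unfolding diag_eigen_def by (rule hermite_rows_D3[OF a0])

text \<open>The cubic in D_1 takes values at -2n and 4 - 2n that differ by 12 times the eigenvalue
  of D_3 on u_n; the term -12 D_3 removes this difference.\<close>

lemma scalar_eigen_Z1: "scalar_eigen a (Z1 a) [:0, 8 - 96 / a^2, - 12, - 8:]"
  unfolding scalar_eigen_def
proof
  fix n
  have "diag_eigen a n (Z1 a)
     ((- 2 * of_nat n) ^ 3 - 3 * (- 2 * of_nat n) ^ 2 - ((4 * a^2 - 48) / a^2) * (- 2 * of_nat n) - 12 * 0)
     ((4 - 2 * of_nat n) ^ 3 - 3 * (4 - 2 * of_nat n) ^ 2 - ((4 * a^2 - 48) / a^2) * (4 - 2 * of_nat n) -
       12 * (16 / a^2 + 4 * of_nat n * (of_nat n - 1)))"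
    unfolding Z1_def
    by (intro diag_eigen_diff diag_eigen_power diag_eigen_scale diag_eigen_D1 diag_eigen_D3)
  moreover have "((- 2 * of_nat n) ^ 3 - 3 * (- 2 * of_nat n) ^ 2 - ((4 * a^2 - 48) / a^2) * (- 2 * of_nat n) - 12 * 0)
       = poly [:0, 8 - 96 / a^2, - 12, - 8:] (of_nat n)"
    by (simp add: field_simps a0 power2_eq_square power3_eq_cube)
  moreover have "((4 - 2 * of_nat n) ^ 3 - 3 * (4 - 2 * of_nat n) ^ 2 - ((4 * a^2 - 48) / a^2) * (4 - 2 * of_nat n) -
       12 * (16 / a^2 + 4 * of_nat n * (of_nat n - 1)))
       = poly [:0, 8 - 96 / a^2, - 12, - 8:] (of_nat n)"
    by (simp add: field_simps a0 power2_eq_square power3_eq_cube)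
  ultimately show "diag_eigen a n (Z1 a) (poly [:0, 8 - 96 / a^2, - 12, - 8:] (of_nat n))
     (poly [:0, 8 - 96 / a^2, - 12, - 8:] (of_nat n))" by simp
qed

text \<open>D_2 swaps the two rows, so its square multiplies both by the product of its two
  off-diagonal entries.\<close>

lemma scalar_eigen_Z2: "scalar_eigen a (Z2 a) ([:8 + 16 / a^2, 12, 4:] * [:16 / a^2, - 4, 4:])"
  unfolding scalar_eigen_def
proof
  fix n
  let ?\<mu> = "- 16 / a^2 - 4 * (of_nat n + 1) * (of_nat n + 2)"
  let ?\<nu> = "- 16 / a^2 - 4 * of_nat n * (of_nat n - 1) :: complex"
  have "?\<mu> * ?\<nu> = poly ([:8 + 16 / a^2, 12, 4:] * [:16 / a^2, - 4, 4:]) (of_nat n)"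
    by (simp add: algebra_simps)
  then show "diag_eigen a n (Z2 a) (poly ([:8 + 16 / a^2, 12, 4:] * [:16 / a^2, - 4, 4:]) (of_nat n))
     (poly ([:8 + 16 / a^2, 12, 4:] * [:16 / a^2, - 4, 4:]) (of_nat n))"
    using dact_mult_eigen[OF hermite_rows_D2[OF a0, of n] hermite_rows_D2[OF a0, of n]]
    by (simp only: diag_eigen_def Z2_def power2_eq_square[of "D2 a"] mat2_mult mult.commute[of ?\<nu>]) simp
qed

text \<open>On v_n only the terms in D_1 alone survive and give the quintic; on u_n the terms with
  D_3 restore the same value.\<close>

lemma scalar_eigen_Z3:
  "scalar_eigen a (Z3 a)
     [:0, - 64 * (a^4 + 40 * a^2 + 120) / (3 * a^4), - 160, 160 * (a^2 - 8) / (3 * a^2), 0, - 32:]"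
    (is "scalar_eigen a _ ?z")
  unfolding scalar_eigen_def
proof
  fix n
  have Z3: "diag_eigen a n (Z3 a)
     (l ^ 5 - 20 * m ^ 2 - 80 * (m * l) - (20 * (a^2 - 8) / (3 * a^2)) * l ^ 3 - 40 * l ^ 2
       + (32 * (a^4 + 40 * a^2 + 120) / (3 * a^4)) * l)
     (l' ^ 5 - 20 * m' ^ 2 - 80 * (m' * l') - (20 * (a^2 - 8) / (3 * a^2)) * l' ^ 3 - 40 * l' ^ 2
       + (32 * (a^4 + 40 * a^2 + 120) / (3 * a^4)) * l')"
     if "diag_eigen a n (D1 a) l l'" "diag_eigen a n (D3 a) m m'" for l m l' m'
    unfolding Z3_def
    by (intro diag_eigen_add diag_eigen_diff diag_eigen_power diag_eigen_scale diag_eigen_mult that)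
  have p: "(- 2 * of_nat n) ^ 5 - 20 * 0 ^ 2 - 80 * (0 * (- 2 * of_nat n)) - (20 * (a^2 - 8) / (3 * a^2)) * (- 2 * of_nat n) ^ 3 - 40 * (- 2 * of_nat n) ^ 2
       + (32 * (a^4 + 40 * a^2 + 120) / (3 * a^4)) * (- 2 * of_nat n) = poly ?z (of_nat n)"
    by (simp add: field_simps a0 eval_nat_numeral)
  define l :: complex where "l = 4 - 2 * of_nat n"
  define m where "m = 16 / a^2 + 4 * of_nat n * (of_nat n - 1)"
  have q: "l ^ 5 - 20 * m ^ 2 - 80 * (m * l) - (20 * (a^2 - 8) / (3 * a^2)) * l ^ 3 - 40 * l ^ 2
       + (32 * (a^4 + 40 * a^2 + 120) / (3 * a^4)) * l = poly ?z (of_nat n)"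
    unfolding l_def m_def
    by (simp add: field_simps a0 eval_nat_numeral)
  show "diag_eigen a n (Z3 a) (poly ?z (of_nat n)) (poly ?z (of_nat n))"
    using Z3[OF diag_eigen_D1 diag_eigen_D3] unfolding p q[unfolded l_def m_def] .
qed

end

subsection \<open>Polynomial dependence on the degree\<close>

lemma higher_pderiv_monom_one:
  "(pderiv ^^ i) (monom 1 m) = monom (\<Prod>j<i. of_nat m - of_nat j :: complex) (m - i)"
proof (induction i)
  case (Suc i)
  show ?case
  proof (cases "i \<le> m")
    case True
    then show ?thesis by (simp add: Suc pderiv_monom of_nat_diff mult.commute)
  next
    \<comment> \<open>The truncated exponent m - i is harmless, since the factor with j = m is
      0.\<close>
    case False
    then have "(\<Prod>j<i. of_nat m - of_nat j :: complex) = 0"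
      by (intro prod_zero bexI[of _ m]) auto
    then show ?thesis
      by (simp only: funpow.simps comp_def Suc prod.lessThan_Suc) simp
  qed
qed simp

text \<open>The coefficient is a falling factorial of n + s, polynomial in n, times the coefficient
  of F at i - s, an index free of n. If n + s < i the falling factorial vanishes.\<close>

lemma coeff_higher_pderiv_monom_mult:
  "\<exists>p. \<forall>n. coeff ((pderiv ^^ i) (monom 1 (n + s)) * F) n = poly p (of_nat n :: complex)"
proof (intro exI allI)
  fix n
  let ?p = "smult (if s \<le> i then coeff F (i - s) else 0) (\<Prod>j<i. [:of_nat s - of_nat j, 1:])"
  define c :: complex where "c = (\<Prod>j<i. of_nat (n + s) - of_nat j)"
  have p: "poly ?p (of_nat n) = (if s \<le> i then coeff F (i - s) else 0) * c"
    by (simp add: c_def poly_prod algebra_simps)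
  have "c = 0" if "n + s < i"
    unfolding c_def using that by (intro prod_zero bexI[of _ "n + s"]) auto
  then show "coeff ((pderiv ^^ i) (monom 1 (n + s)) * F) n = poly ?p (of_nat n)"
    unfolding p higher_pderiv_monom_one c_def[symmetric]
    by (cases "i \<le> n + s") (auto simp: coeff_monom_mult)
qed

lemma polynomial_in_n_sum:
  assumes "\<And>i. \<exists>p. \<forall>n. f i n = poly p (of_nat n :: complex)"
  shows "\<exists>p. \<forall>n. (\<Sum>i\<in>A. f i n) = poly p (of_nat n)"
proof -
  obtain p where "f i n = poly (p i) (of_nat n)" for i n using assms by metis
  then show ?thesis by (intro exI[of _ "\<Sum>i\<in>A. p i"]) (simp add: poly_sum)
qed

lemma polynomial_in_n_add_scaled:
  assumes "\<exists>p. \<forall>n. f n = poly p (of_nat n :: complex)" "\<exists>p. \<forall>n. g n = poly p (of_nat n :: complex)"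
  shows "\<exists>p. \<forall>n. f n + c * g n = poly p (of_nat n)"
proof -
  obtain p q where "f n = poly p (of_nat n)" "g n = poly q (of_nat n)" for n using assms by metis
  then show ?thesis by (intro exI[of _ "p + smult c q"]) simp
qed

lemma poly_eqI_of_nat:
  assumes "\<And>n. poly p (of_nat n) = poly q (of_nat n :: complex)"
  shows "p = q"
proof (rule ccontr)
  assume "p \<noteq> q"
  then have "finite {x. poly (p - q) x = 0}" by (intro poly_roots_finite) simp
  moreover have "range of_nat \<subseteq> {x. poly (p - q) x = 0}" using assms by auto
  ultimately have "finite (range (of_nat :: nat \<Rightarrow> complex))" by (rule finite_subset[rotated])
  then show False using range_inj_infinite[of "of_nat :: nat \<Rightarrow> complex"] by (simp add: inj_on_def)
qed

text \<open>D preserves the degree filtration, so \<open>z n\<close> is the leading coefficient of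
  its action on x^n I, which is polynomial in n.\<close>

lemma scalar_eigenvalue_polynomial:
  assumes D: "\<And>n. diag_eigen (of_real a) n D (z n) (z n)"
  shows "\<exists>p. \<forall>n. z n = poly p (of_nat n)"
proof -
  let ?K = "hermite_rows (of_real a)"
  have mat: "mat2 c 0 0 c = mat c" for c :: complex by (rule mat2_eqI) (simp_all add: mat_def)
  have D': "?K n \<bullet>\<^sub>D D = mat_const (mat (z n)) ** ?K n" for n
    using D[of n] by (simp add: diag_eigen_def mat)
  have pres: "P \<bullet>\<^sub>D D \<in> degree_less n" if "P \<in> degree_less n" for P n
    using that
  proof (rule degree_less_induct[of ?K, OF hermite_rows_degree hermite_rows_lead_invertible])
    fix C m assume "m < n"
    then show "mat_const C ** ?K m \<bullet>\<^sub>D D \<in> degree_less n"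
      unfolding dact_mat_const_mult D'
      by (intro degree_less_mat_const_mult degree_less_mono[OF hermite_rows_degree]) simp
  qed (auto simp: degree_less_zero degree_less_add dact_add_left)
  \<comment> \<open>The matrices x^n I and \<open>?P\<close> are both monic; they differ in degree
    below n, which D does not raise.\<close>
  have "z n = coeff ((mat (monom 1 n) \<bullet>\<^sub>D D) $ 1 $ 1) n" for n
  proof -
    let ?L = "mat_coeff (?K n) n"
    let ?P = "mat_const (matrix_inv ?L) ** ?K n"
    have P: "mat_coeff ?P n = mat 1"
      by (simp add: matrix_inv_left hermite_rows_lead_invertible)
    have M: "mat (monom 1 n) \<in> degree_less (Suc n)" "mat_coeff (mat (monom 1 n)) n = mat 1"
      by (auto simp: degree_less_def mat_def vec_eq_iff)
    have "mat_coeff (mat (monom 1 n) - ?P) n = 0"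
      unfolding mat_coeff_diff M P by simp
    then have "mat (monom 1 n) - ?P \<in> degree_less n"
      by (subst degree_less_Suc_iff) (simp add: degree_less_diff M degree_less_mat_const_mult hermite_rows_degree)
    then have "mat_coeff ((mat (monom 1 n) - ?P) \<bullet>\<^sub>D D) n = 0"
      using pres degree_less_Suc_iff by blast
    then have "mat_coeff (mat (monom 1 n) \<bullet>\<^sub>D D) n = mat_coeff (?P \<bullet>\<^sub>D D) n"
      by (simp add: dact_diff_left)
    also have "?P \<bullet>\<^sub>D D = mat_const (mat (z n)) ** ?P"
    proof -
      have "matrix_inv ?L ** mat (z n) = mat (z n) ** matrix_inv ?L"
        by (rule mat2_eqI) (simp_all add: mult2_nth mat_def mult.commute)
      then show ?thesis
        by (simp add: dact_mat_const_mult D' matrix_mul_assoc flip: mat_const_mult)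
    qed
    also have "mat_coeff (mat_const (mat (z n)) ** ?P) n = mat (z n)"
      unfolding mat_coeff_mat_const_mult[of "mat (z n)"] P by simp
    finally have "mat_coeff (mat (monom 1 n) \<bullet>\<^sub>D D) n = mat (z n)" .
    from arg_cong[OF this, of "\<lambda>A. A $ 1 $ 1"] show ?thesis by (simp add: mat_def)
  qed
  moreover have "\<exists>p. \<forall>n. coeff ((mat (monom 1 n) \<bullet>\<^sub>D D) $ 1 $ 1) n = poly p (of_nat n)"
    unfolding dact_def sum_component coeff_sum funpow_mat_deriv_mat mat_mult_component
    by (rule polynomial_in_n_sum) (use coeff_higher_pderiv_monom_mult[where s = 0] in simp)
  ultimately show ?thesis by simp
qed

text \<open>Being diagonal in the Hermite basis, the map preserves degrees, and x^n - h_n has degree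
  below n.\<close>

lemma coeff_hermite_eigenoperator:
  fixes \<Psi> :: "complex poly \<Rightarrow> complex poly"
  assumes add: "\<And>p q. \<Psi> (p + q) = \<Psi> p + \<Psi> q" and smult: "\<And>c p. \<Psi> (smult c p) = smult c (\<Psi> p)"
    and eig: "\<And>n. \<Psi> (hermite n) = smult (\<alpha> n) (hermite n)"
  shows "coeff (\<Psi> (monom 1 n)) n = \<alpha> n"
proof -
  have pres: "\<forall>k\<ge>n. coeff (\<Psi> p) k = 0" if "\<forall>k\<ge>n. coeff p k = 0" for n p
    using that
  proof (induction n arbitrary: p)
    case 0
    then have "p = 0" by (simp add: poly_eq_iff)
    then show ?case using smult[of 0 0] by simp
  next
    case (Suc n)
    define q where "q = p - smult (coeff p n) (hermite n)"
    have "coeff q k = 0" if "n \<le> k" for k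
      using that Suc.prems by (cases "k = n") (auto simp: q_def coeff_hermite)
    then have "\<forall>k\<ge>n. coeff (\<Psi> q) k = 0" using Suc.IH by blast
    moreover have "\<Psi> p = \<Psi> q + smult (coeff p n) (smult (\<alpha> n) (hermite n))"
      unfolding eig[symmetric] smult[symmetric] add[symmetric] by (simp add: q_def)
    ultimately show ?case by (simp add: coeff_hermite)
  qed
  have "coeff (\<Psi> (monom 1 n - hermite n)) n = 0"
    using pres[of n "monom 1 n - hermite n"] by (simp add: coeff_hermite)
  moreover have "\<Psi> (monom 1 n) = \<Psi> (monom 1 n - hermite n) + \<Psi> (hermite n)"
    by (simp flip: add)
  ultimately show ?thesis by (simp add: eig coeff_hermite)
qed

text \<open>The row (h_n, 0) is (v_n + a u_(n+2))/(1 + w_n), so the first entry of its image is h_n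
  times a weighted mean of z_n and z_(n+2). As a leading coefficient, this mean must be polynomial
  in n.\<close>

lemma scalar_eigenvalue_shift:
  fixes a :: real
  defines "w \<equiv> \<lambda>n. (of_real a)^2 * (of_nat n + 1) * (of_nat n + 2) / 4 :: complex"
  assumes D: "\<And>n. diag_eigen (of_real a) n D (z n) (z n)"
  shows "\<exists>p. \<forall>n. (1 + w n) * poly p (of_nat n) = z n + w n * z (n + 2)"
proof -
  let ?a = "complex_of_real a"
  have w0: "1 + w n \<noteq> 0" for n
    using hermite_rows_norm_nonzero[of a "n + 2"] by (simp add: w_def algebra_simps)
  \<comment> \<open>The first row is (p, 0) times the inverse of T.\<close>
  define M where "M = (\<lambda>p. mat2 p (smult (- ?a) (monom 1 2 * p)) 0 0)"
  define \<Psi> where "\<Psi> = (\<lambda>p. (M p \<bullet>\<^sub>D D) $ 1 $ 1)"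
  have "coeff (\<Psi> (monom 1 n)) n = (z n + w n * z (n + 2)) / (1 + w n)" for n
  proof (rule coeff_hermite_eigenoperator)
    show "\<Psi> (p + q) = \<Psi> p + \<Psi> q" for p q
    proof -
      have "M (p + q) = M p + M q"
        by (rule mat2_eqI) (simp_all add: M_def algebra_simps smult_add_right)
      then show ?thesis by (simp add: \<Psi>_def dact_add_left)
    qed
    show "\<Psi> (smult c p) = smult c (\<Psi> p)" for c p
    proof -
      have "M (smult c p) = mat_const (mat c) ** M p"
        by (rule mat2_eqI) (simp_all add: M_def mult2_nth mat_def)
      then show ?thesis by (simp add: \<Psi>_def dact_mat_const_mult mult2_nth mat_def)
    qed
    fix n
    define s where "s = 1 / (1 + w n)"
    have h2: "pderiv (pderiv (hermite (n + 2))) = smult ((of_nat n + 1) * (of_nat n + 2)) (hermite n)"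
      by (simp add: pderiv_hermite_Suc pderiv_smult algebra_simps del: hermite.simps)
    have s: "s + s * w n = 1" using w0[of n] by (simp add: s_def field_simps)
    \<comment> \<open>By \<open>h2\<close>, the first entry of a u_(n+2) is w_n h_n; the second
      entries of v_n and a u_(n+2) cancel.\<close>
    have "M (hermite n) = mat_const (mat2 s 0 0 0) ** hermite_rows ?a n + mat_const (mat2 0 (s * ?a) 0 0) ** hermite_rows ?a (n + 2)"
      (is "_ = ?R")
    proof (rule mat2_eqI; rule iffD1[OF poly_eq_poly_eq_iff]; rule ext)
      fix t
      have "poly (?R $ 1 $ 1) t = (s + s * w n) * poly (hermite n) t"
        unfolding hermite_rows_def Let_def h2
        by (simp add: mult2_nth w_def algebra_simps power2_eq_square del: hermite.simps)
      then show "poly (M (hermite n) $ 1 $ 1) t = poly (?R $ 1 $ 1) t"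
        by (simp add: M_def s)
      have "poly (?R $ 1 $ 2) t = (s + s * w n) * (- ?a * t\<^sup>2 * poly (hermite n) t)"
        unfolding hermite_rows_def Let_def h2
        by (simp add: mult2_nth w_def algebra_simps power2_eq_square del: hermite.simps)
      then show "poly (M (hermite n) $ 1 $ 2) t = poly (?R $ 1 $ 2) t"
        by (simp add: M_def s poly_monom)
    qed (simp_all add: M_def mult2_nth)
    then have "\<Psi> (hermite n) = (mat_const (mat2 s 0 0 0) ** (hermite_rows ?a n \<bullet>\<^sub>D D) + mat_const (mat2 0 (s * ?a) 0 0) ** (hermite_rows ?a (n + 2) \<bullet>\<^sub>D D)) $ 1 $ 1"
      by (simp add: \<Psi>_def dact_add_left dact_mat_const_mult)
    also have "\<dots> = smult (s * z n) (hermite n) + smult (s * ?a * z (n + 2) * ?a / 4) (pderiv (pderiv (hermite (n + 2))))"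
      using D[of n] D[of "n + 2"]
      by (simp add: diag_eigen_def mult2_nth hermite_rows_def Let_def mult_ac del: hermite.simps)
    also have "\<dots> = smult ((z n + w n * z (n + 2)) / (1 + w n)) (hermite n)"
      unfolding h2 by (simp add: s_def w_def smult_add_left[symmetric] add_divide_distrib power2_eq_square mult_ac)
    finally show "\<Psi> (hermite n) = smult ((z n + w n * z (n + 2)) / (1 + w n)) (hermite n)" .
  qed
  moreover have "\<exists>p. \<forall>n. coeff (\<Psi> (monom 1 n)) n = poly p (of_nat n)"
  proof -
    \<comment> \<open>The entry -a x^(n+2) of M accounts for the shift 2.\<close>
    have "coeff (\<Psi> (monom 1 n)) n = (\<Sum>i\<le>degree (symbol D).
        coeff ((pderiv ^^ i) (monom 1 n) * dcoeff D i $ 1 $ 1) n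
        + - ?a * coeff ((pderiv ^^ i) (monom 1 (n + 2)) * dcoeff D i $ 2 $ 1) n)" for n
      unfolding \<Psi>_def M_def dact_def sum_component coeff_sum mult2_nth funpow_mat_deriv_nth mat2_nth
        higher_pderiv_smult mult_monom coeff_add mult_smult_left coeff_smult mult_1 add.commute[of 2] ..
    then show ?thesis
      by (simp only:) (intro polynomial_in_n_sum polynomial_in_n_add_scaled coeff_higher_pderiv_monom_mult
        coeff_higher_pderiv_monom_mult[where s = 0, unfolded add_0_right])
  qed
  ultimately obtain p where "poly p (of_nat n) = (z n + w n * z (n + 2)) / (1 + w n)" for n by metis
  then show ?thesis using w0 by (intro exI[of _ p]) simp
qed

section \<open>The degree gap and generation by Z_1, Z_2, Z_3\<close>

lemma scalar_eigen_low_degree: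
  fixes a :: real
  assumes "a \<noteq> 0" "scalar_eigen (of_real a) D z" "degree z \<le> 2"
  shows "z = [:coeff z 0:]"
proof -
  let ?a = "complex_of_real a"
  \<comment> \<open>This is 1 + w_n as a polynomial in n, quadratic since a is nonzero. It divides
    z(n) - z(n+2), which has degree at most 1, so that difference is 0 and z is constant.\<close>
  define \<pi> where "\<pi> = [:1 + ?a^2 / 2, 3 * ?a^2 / 4, ?a^2 / 4:]"
  obtain p where p: "(1 + ?a^2 * (of_nat n + 1) * (of_nat n + 2) / 4) * poly p (of_nat n) =
      poly z (of_nat n) + ?a^2 * (of_nat n + 1) * (of_nat n + 2) / 4 * poly z (of_nat n + 2)" for n
    using scalar_eigenvalue_shift[of a D "\<lambda>n. poly z (of_nat n)"] assms(2) by (auto simp: scalar_eigen_def add.commute)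
  define r where "r = p - pcompose z [:2, 1:]"
  have eq: "\<pi> * r = z - pcompose z [:2, 1:]"
  proof (rule poly_eqI_of_nat)
    fix n
    define x where "x = complex_of_nat n"
    define w where "w = ?a^2 * (x + 1) * (x + 2) / 4"
    have "poly \<pi> x = 1 + w"
      by (simp add: \<pi>_def w_def field_simps power2_eq_square)
    moreover have "poly r x = poly p x - poly z (x + 2)"
      by (simp add: r_def poly_pcompose add.commute)
    moreover have "(1 + w) * poly p x = poly z x + w * poly z (x + 2)"
      using p[of n] by (simp add: w_def x_def)
    then have "(1 + w) * (poly p x - poly z (x + 2)) = poly z x - poly z (x + 2)"
      by (simp add: algebra_simps)
    ultimately show "poly (\<pi> * r) (of_nat n) = poly (z - pcompose z [:2, 1:]) (of_nat n)"
      by (simp add: x_def[symmetric] poly_pcompose add.commute)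
  qed
  obtain z0 z1 z2 where z: "z = [:z0, z1, z2:]"
  proof
    show "z = [:coeff z 0, coeff z 1, coeff z 2:]"
      using assms(3) by (auto simp: poly_eq_iff coeff_pCons coeff_eq_0 numeral_2_eq_2 split: nat.split)
  qed
  have low: "z - pcompose z [:2, 1:] = [:- 2 * z1 - 4 * z2, - 4 * z2:]"
    by (simp add: z pcompose_pCons)
  have "r = 0"
  proof (rule ccontr)
    assume "r \<noteq> 0"
    moreover have "\<pi> \<noteq> 0" "degree \<pi> = 2" using assms(1) by (simp_all add: \<pi>_def)
    ultimately have "degree (\<pi> * r) \<ge> 2" by (simp add: degree_mult_eq)
    moreover have "degree [:- 2 * z1 - 4 * z2, - 4 * z2:] \<le> 1" by simp
    ultimately show False unfolding eq low by linarith
  qed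
  then have 0: "[:- 2 * z1 - 4 * z2, - 4 * z2:] = 0"
    unfolding low[symmetric] eq[symmetric] by simp
  then have "z2 = 0" by simp
  with 0 have "z1 = 0" by auto
  with \<open>z2 = 0\<close> show ?thesis by (simp add: z)
qed

lemma is_subalgebra_generated: "is_subalgebra (generated_algebra S)"
  by (rule hull_in) (auto simp: is_subalgebra_def)

text \<open>Induction on the degree of z: leading terms are removed by elements of G of every degree
  at least 3, until the degree gap leaves a constant.\<close>

lemma scalar_eigen_generated:
  fixes a :: real
  defines "G \<equiv> generated_algebra {1, Z1 a, Z2 a, Z3 a}"
  assumes a: "a \<noteq> 0" and "scalar_eigen (of_real a) D z"
  shows "D \<in> G"
proof -
  have a': "complex_of_real a \<noteq> 0" using a by simp
  have G: "1 \<in> G" "\<And>D E. D \<in> G \<Longrightarrow> E \<in> G \<Longrightarrow> D + E \<in> G" "\<And>D E. D \<in> G \<Longrightarrow> E \<in> G \<Longrightarrow> D * E \<in> G"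
    "\<And>c D. D \<in> G \<Longrightarrow> c *\<^sub>D D \<in> G"
    using is_subalgebra_generated[of "{1, Z1 a, Z2 a, Z3 a}"] by (auto simp: G_def is_subalgebra_def)
  have gen: "Z1 a \<in> G" "Z2 a \<in> G" "Z3 a \<in> G"
    by (auto simp: G_def intro: hull_inc)
  have mono: "\<exists>M\<in>G. \<exists>m. scalar_eigen (of_real a) M m \<and> degree m = d" if "d \<ge> 3" for d
    using that
  proof (induction d rule: less_induct)
    case (less d)
    \<comment> \<open>Degrees 3, 4, 5 are the generators; from 6 on, multiplication by Z_1 raises
      degree d - 3 to d.\<close>
    consider "d = 3" | "d = 4" | "d = 5" | "d - 3 \<ge> 3" "d - 3 < d" "d = 3 + (d - 3)" using less.prems by linarith
    then show ?case
    proof cases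
      case 1
      then show ?thesis using gen(1) scalar_eigen_Z1[OF a'] by force
    next
      case 2
      then show ?thesis using gen(2) scalar_eigen_Z2[OF a'] by (intro bexI[of _ "Z2 a"] exI) (auto simp: degree_mult_eq)
    next
      case 3
      then show ?thesis using gen(3) scalar_eigen_Z3[OF a'] by force
    next
      case 4
      then obtain M m where M: "M \<in> G" "scalar_eigen (of_real a) M m" "degree m = d - 3"
        using less.IH by blast
      let ?m = "[:0, 8 - 96 / complex_of_real a^2, - 12, - 8:] * m"
      have "scalar_eigen (of_real a) (Z1 a * M) ?m"
        using scalar_eigen_Z1[OF a'] M(2) unfolding scalar_eigen_def poly_mult by (blast intro: diag_eigen_mult)
      moreover have "m \<noteq> 0" using M(3) 4 by auto
      then have "degree ?m = 3 + (d - 3)"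
        using M(3) by (subst degree_mult_eq) auto
      ultimately show ?thesis using G(3)[OF gen(1) M(1)] 4 by metis
    qed
  qed
  show ?thesis
    using assms(3)
  proof (induction "degree z" arbitrary: D z rule: less_induct)
    case less
    show ?case
    proof (cases "degree z \<le> 2")
      case True
      then obtain c where c: "z = [:c:]" using scalar_eigen_low_degree[OF a less.prems] by blast
      have "D = c *\<^sub>D 1"
      proof (rule dact_eqI_on_basis[of "hermite_rows (of_real a)", OF hermite_rows_degree hermite_rows_lead_invertible])
        fix n
        have "diag_eigen (of_real a) n D c c" using less.prems by (simp add: scalar_eigen_def c)
        moreover have "diag_eigen (of_real a) n (c *\<^sub>D 1) c c"
          using diag_eigen_scale[OF diag_eigen_1] by simp
        ultimately show "hermite_rows (of_real a) n \<bullet>\<^sub>D D = hermite_rows (of_real a) n \<bullet>\<^sub>D (c *\<^sub>D 1)"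
          by (simp add: diag_eigen_def)
      qed
      then show ?thesis using G by simp
    next
      case False
      then obtain M m where M: "M \<in> G" "scalar_eigen (of_real a) M m" "degree m = degree z"
        using mono[of "degree z"] by auto
      define c where "c = lead_coeff z / lead_coeff m"
      let ?z = "z - smult c m"
      have "m \<noteq> 0" using M(3) False by auto
      then have m0: "lead_coeff m \<noteq> 0" by simp
      have "coeff ?z (degree z) = 0" using m0 M(3) by (simp add: c_def)
      moreover have "degree ?z \<le> degree z"
        using M(3) by (intro degree_diff_le) (auto intro: order_trans[OF degree_smult_le])
      ultimately have "degree ?z < degree z"
        using False by (metis degree_0 leading_coeff_0_iff le_less zero_le)
      moreover have "scalar_eigen (of_real a) (D - c *\<^sub>D M) ?z"
        using less.prems M(2) unfolding scalar_eigen_def poly_diff poly_smult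
        by (blast intro: diag_eigen_diff diag_eigen_scale)
      ultimately have "D - c *\<^sub>D M \<in> G" by (rule less.hyps)
      from G(2)[OF this G(4)[OF M(1)], of c] show ?thesis by simp
    qed
  qed
qed

theorem proposition5p10:
  fixes a :: real
  assumes "a \<noteq> 0"
  shows "{D1 a, D2 a, D3 a} \<subseteq> weight_algebra (-\<infinity>) \<infinity> (W a) \<and>
    center (weight_algebra (-\<infinity>) \<infinity> (W a)) = generated_algebra {1, Z1 a, Z2 a, Z3 a}"
proof -
  have a': "complex_of_real a \<noteq> 0" using assms by simp
  let ?A = "weight_algebra (-\<infinity>) \<infinity> (W a)"
  let ?K = "hermite_rows (of_real a)"
  \<comment> \<open>Operators acting as a scalar on each \<open>?K n\<close>. The proof closes the
    cycle \<open>?S\<close>, center, generated algebra, \<open>?S\<close> of inclusions.\<close>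
  let ?S = "{D. \<exists>z. \<forall>n. diag_eigen (of_real a) n D (z n) (z n)}"
  have comm: "A ** mat2 c 0 0 c = mat2 c 0 0 c ** A" for A :: "complex^2^2" and c
    by (rule mat2_eqI) (simp_all add: mult2_nth mult.commute)
  have D: "{D1 a, D2 a, D3 a} \<subseteq> ?A"
    using hermite_rows_D1[OF a'] hermite_rows_D2[OF a'] hermite_rows_D3[OF a'] by (auto simp: weight_algebra_W_iff)
  have "?S \<subseteq> center ?A"
  proof
    fix Z assume "Z \<in> ?S"
    then obtain z where z: "?K n \<bullet>\<^sub>D Z = mat_const (mat2 (z n) 0 0 (z n)) ** ?K n" for n
      by (auto simp: diag_eigen_def)
    have "Z * E = E * Z" if E: "E \<in> ?A" for E
    proof (rule dact_eqI_on_basis[of ?K, OF hermite_rows_degree hermite_rows_lead_invertible])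
      fix n
      obtain \<Lambda> where "?K n \<bullet>\<^sub>D E = mat_const \<Lambda> ** ?K n" using E by (auto simp: weight_algebra_W_iff)
      then show "?K n \<bullet>\<^sub>D (Z * E) = ?K n \<bullet>\<^sub>D (E * Z)"
        using dact_mult_eigen[OF z] dact_mult_eigen[OF _ z] comm[of \<Lambda>] by simp
    qed
    moreover have "Z \<in> ?A" using z by (auto simp: weight_algebra_W_iff)
    ultimately show "Z \<in> center ?A" by (simp add: center_def)
  qed
  moreover have "center ?A \<subseteq> generated_algebra {1, Z1 a, Z2 a, Z3 a}"
  proof
    fix Z assume Z: "Z \<in> center ?A"
    \<comment> \<open>The eigenvalue matrix commutes with those of D_1 and D_2: distinct diagonal
      entries make it diagonal, and \<mu> \<noteq> 0 makes its diagonal entries equal.\<close>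
    have "\<exists>z. diag_eigen (of_real a) n Z z z" for n
    proof -
      obtain \<Lambda> where \<Lambda>: "?K n \<bullet>\<^sub>D Z = mat_const \<Lambda> ** ?K n"
        using Z by (auto simp: center_def weight_algebra_W_iff)
      have commutes: "\<Lambda> ** B = B ** \<Lambda>" if "E \<in> ?A" "?K n \<bullet>\<^sub>D E = mat_const B ** ?K n" for E B
      proof (rule mat_const_mult_cancel[OF hermite_rows_lead_invertible])
        show "mat_const (\<Lambda> ** B) ** ?K n = mat_const (B ** \<Lambda>) ** ?K n"
          using Z that dact_mult_eigen[OF \<Lambda> that(2)] dact_mult_eigen[OF that(2) \<Lambda>] by (simp add: center_def)
      qed
      define \<mu> where "\<mu> = - 16 / (complex_of_real a)^2 - 4 * (of_nat n + 1) * (of_nat n + 2)"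
      have "\<mu> = of_real (- (16 / a^2 + 4 * (real n + 1) * (real n + 2)))" by (simp add: \<mu>_def)
      moreover have "16 / a^2 + 4 * (real n + 1) * (real n + 2) > 0"
        using assms by (intro add_pos_pos) auto
      ultimately have \<mu>: "\<mu> \<noteq> 0" by (metis of_real_eq_0_iff neg_equal_0_iff_equal less_irrefl)
      have c1: "\<Lambda> ** mat2 (- 2 * of_nat n) 0 0 (4 - 2 * of_nat n) = mat2 (- 2 * of_nat n) 0 0 (4 - 2 * of_nat n) ** \<Lambda>"
        using D by (intro commutes[OF _ hermite_rows_D1[OF a']]) simp
      have off: "\<Lambda> $ 1 $ 2 = 0" "\<Lambda> $ 2 $ 1 = 0"
        using arg_cong[OF c1, of "\<lambda>A. A $ 1 $ 2"] arg_cong[OF c1, of "\<lambda>A. A $ 2 $ 1"]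
        by (simp_all add: mult2_nth algebra_simps)
      have c2: "\<Lambda> ** mat2 0 \<mu> \<nu> 0 = mat2 0 \<mu> \<nu> 0 ** \<Lambda>"
        if "\<nu> = - 16 / (complex_of_real a)^2 - 4 * of_nat n * (of_nat n - 1)" for \<nu>
        using D unfolding \<mu>_def that by (intro commutes[OF _ hermite_rows_D2[OF a']]) simp
      have "\<Lambda> $ 1 $ 1 = \<Lambda> $ 2 $ 2"
        using arg_cong[OF c2[OF refl], of "\<lambda>A. A $ 1 $ 2"] \<mu> by (simp add: mult2_nth)
      then have "mat2 (\<Lambda> $ 1 $ 1) 0 0 (\<Lambda> $ 1 $ 1) = \<Lambda>"
        using off by (intro mat2_eqI) simp_all
      then show ?thesis
        using \<Lambda> unfolding diag_eigen_def by (intro exI[of _ "\<Lambda> $ 1 $ 1"]) (simp only:)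
    qed
    then obtain z where z: "diag_eigen (of_real a) n Z (z n) (z n)" for n by metis
    moreover obtain p where "z n = poly p (of_nat n)" for n
      using scalar_eigenvalue_polynomial[of a Z z] z by blast
    ultimately have "scalar_eigen (of_real a) Z p" by (simp add: scalar_eigen_def)
    then show "Z \<in> generated_algebra {1, Z1 a, Z2 a, Z3 a}"
      by (rule scalar_eigen_generated[OF assms])
  qed
  moreover have "generated_algebra {1, Z1 a, Z2 a, Z3 a} \<subseteq> ?S"
  proof (rule hull_minimal)
    have SI: "E \<in> ?S" if "\<And>n. diag_eigen (of_real a) n E (z n) (z n)" for E z
      using that by (intro CollectI exI allI)
    have one: "1 \<in> ?S"
      by (rule SI[of _ "\<lambda>_. 1"]) (rule diag_eigen_1)
    have "D \<in> ?S" if "scalar_eigen (of_real a) D z" for D z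
      using that unfolding scalar_eigen_def by (intro SI) blast
    with one show "{1, Z1 a, Z2 a, Z3 a} \<subseteq> ?S"
      using scalar_eigen_Z1[OF a'] scalar_eigen_Z2[OF a'] scalar_eigen_Z3[OF a'] by blast
    show "is_subalgebra ?S"
      unfolding is_subalgebra_def
    proof (intro conjI ballI allI)
      show "1 \<in> ?S" by (rule one)
    next
      fix D E assume "D \<in> ?S" "E \<in> ?S"
      then obtain y z where *: "diag_eigen (of_real a) n D (y n) (y n)" "diag_eigen (of_real a) n E (z n) (z n)" for n
        by blast
      show "D + E \<in> ?S" by (rule SI[of _ "\<lambda>n. y n + z n"]) (intro diag_eigen_add *)
      show "D * E \<in> ?S" by (rule SI[of _ "\<lambda>n. y n * z n"]) (intro diag_eigen_mult *)
    next
      fix c D assume "D \<in> ?S"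
      then obtain z where *: "diag_eigen (of_real a) n D (z n) (z n)" for n by blast
      show "c *\<^sub>D D \<in> ?S" by (rule SI[of _ "\<lambda>n. c * z n"]) (intro diag_eigen_scale *)
    qed
  qed
  ultimately show ?thesis using D by blast
qed

end
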